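(* Let $T:[0,|\boldsymbol\lambda|]\to[0,|\boldsymbol\lambda|]$ be the map $$T(x)=\begin{cases} -x+\lambda_1+\lambda_3 & \text{if } x\in I_1\\ -x+\lambda_1+|\boldsymbol\lambda| & \text{if } x\in I_2\\ -x+\lambda_1+\lambda_2+\lambda_3 & \text{if } x\in I_3\\ -x+\lambda_1+\lambda_3+|\boldsymbol\lambda| & \text{if } x\in I_4,\end{cases}$$ where the vector $\boldsymbol\lambda=(\lambda_1,\lambda_2,\lambda_3,\lambda_4)$ and the intervals $I_1,\dots,I_4$ are those specified in the context. Then $T$ is minimal and uniquely ergodic.
   Context: Let $$P=\begin{pmatrix}3&3&5&4\\1&2&3&3\\1&1&2&1\\2&3&5&5\end{pmatrix},\qquad Q=\begin{pmatrix}1&0&0&0\\0&1&1&0\\0&0&1&1\\0&1&0&0\end{pmatrix}.$$ Let $\eta$ be the Perron-Frobenius eigenvalue of $P$ and $\boldsymbol\nu=(\nu_1,\nu_2,\nu_3,\nu_4)$ the probability eigenvector with positive entries, $P\boldsymbol\nu=\eta\boldsymbol\nu$. Let $\boldsymbol\lambda=(\lambda_1,\lambda_2,\lambda_3,\lambda_4)=Q\boldsymbol\nu$ and $|\boldsymbol\lambda|=\lambda_1+\lambda_2+\lambda_3+\lambda_4$. Let $I_1=[0,\lambda_1)$, $I_2=[\lambda_1,\lambda_1+\lambda_2)$, $I_3=[\lambda_1+\lambda_2,\lambda_1+\lambda_2+\lambda_3)$, $I_4=[\lambda_1+\lambda_2+\lambda_3,|\boldsymbol\lambda|]$. The $T$-orbit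 of $x$ is $O_T(x)=\{x,T(x),T^2(x),\ldots\}$. $T$ is minimal if every $T$-orbit is dense in $[0,|\boldsymbol\lambda|]$; $T$ is uniquely ergodic if the normalized Lebesgue measure on $[0,|\boldsymbol\lambda|]$ is the only $T$-invariant Borel probability measure. *)

theory Defs
  imports "HOL-Analysis.Lebesgue_Measure" "Jordan_Normal_Form.Spectral_Radius"
begin

(* Both imports use the infix $ for vector components; below it is always the one
   of Jordan_Normal_Form.Matrix, whose vectors and matrices are indexed from 0. *)
unbundle no vec_syntax

definition P_mat :: "real mat" where
  "P_mat = mat_of_rows_list 4
     [[3, 3, 5, 4],
      [1, 2, 3, 3],
      [1, 1, 2, 1],
      [2, 3, 5, 5]]"

definition Q_mat :: "real mat" where
  "Q_mat = mat_of_rows_list 4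
     [[1, 0, 0, 0],
      [0, 1, 1, 0],
      [0, 0, 1, 1],
      [0, 1, 0, 0]]"

definition perron_frobenius_eigenvalue :: "real mat \<Rightarrow> real \<Rightarrow> bool" where
  "perron_frobenius_eigenvalue A r \<longleftrightarrow>
     eigenvalue A r \<and> r = spectral_radius (map_mat complex_of_real A)"

definition positive_probability_vec :: "nat \<Rightarrow> real Matrix.vec \<Rightarrow> bool" where
  "positive_probability_vec n v \<longleftrightarrow>
     v \<in> carrier_vec n \<and> (\<forall>i<n. 0 < v $ i) \<and> (\<Sum>i<n. v $ i) = 1"

definition total_length :: "real Matrix.vec \<Rightarrow> real" where
  "total_length l = l $ 0 + l $ 1 + l $ 2 + l $ 3"

definition interval1 :: "real Matrix.vec \<Rightarrow> real set" where
  "interval1 l = {0 ..< l $ 0}"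

definition interval2 :: "real Matrix.vec \<Rightarrow> real set" where
  "interval2 l = {l $ 0 ..< l $ 0 + l $ 1}"

definition interval3 :: "real Matrix.vec \<Rightarrow> real set" where
  "interval3 l = {l $ 0 + l $ 1 ..< l $ 0 + l $ 1 + l $ 2}"

definition interval4 :: "real Matrix.vec \<Rightarrow> real set" where
  "interval4 l = {l $ 0 + l $ 1 + l $ 2 .. total_length l}"

(* Only the values on {0..total_length l} matter. *)
definition flip_map :: "real Matrix.vec \<Rightarrow> real \<Rightarrow> real" where
  "flip_map l x =
     (if x \<in> interval1 l then - x + l $ 0 + l $ 2
      else if x \<in> interval2 l then - x + l $ 0 + total_length l
      else if x \<in> interval3 l then - x + l $ 0 + l $ 1 + l $ 2
      else if x \<in> interval4 l then - x + l $ 0 + l $ 2 + total_length l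
      else undefined)"

definition forward_orbit :: "('a \<Rightarrow> 'a) \<Rightarrow> 'a \<Rightarrow> 'a set" where
  "forward_orbit T x = {(T ^^ n) x | n. True}"

(* The equality says that the orbit stays in the (closed) interval and is dense in it. *)
definition minimal_on_interval :: "real \<Rightarrow> (real \<Rightarrow> real) \<Rightarrow> bool" where
  "minimal_on_interval L T \<longleftrightarrow> (\<forall>x\<in>{0..L}. closure (forward_orbit T x) = {0..L})"

definition invariant_borel_prob :: "real \<Rightarrow> (real \<Rightarrow> real) \<Rightarrow> real measure \<Rightarrow> bool" where
  "invariant_borel_prob L T M \<longleftrightarrow>
     sets M = sets (restrict_space borel {0..L}) \<and>
     emeasure M (space M) = 1 \<and>
     T \<in> measurable M M \<and> distr M M T = M"

definition normalized_lebesgue :: "real \<Rightarrow> real measure" where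
  "normalized_lebesgue L = uniform_measure (restrict_space lborel {0..L}) {0..L}"

definition uniquely_ergodic_on_interval :: "real \<Rightarrow> (real \<Rightarrow> real) \<Rightarrow> bool" where
  "uniquely_ergodic_on_interval L T \<longleftrightarrow>
     (\<forall>M. invariant_borel_prob L T M \<longleftrightarrow> M = normalized_lebesgue L)"

end

(*
  Let S be the first return map of T to [0, 1], where 1 = nu_1 + ... + nu_4. It exchanges four
  intervals of lengths nu_1, ..., nu_4, reversing the first and the last one, and because
  P nu = eta nu its first return map to [0, 1/eta] is S itself, scaled by 1/eta. All words of
  this renormalization contain all four letters, with P as matrix of letter counts.

  Minimality: by induction on n every orbit comes eta^(-n)-close to every point, since the orbit
  traced on [0, 1/eta] is again an orbit, and a point in the tower over [0, 1/eta] is approached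
  whenever its base point is. To include the orbits that hit the discontinuities, S is replaced
  by the relation given by its closed branches, which allows both one-sided values.

  Unique ergodicity: an invariant measure has no atoms because orbits are infinite, so its
  distribution function Phi is carried by each closed branch to +-Phi + const. Hence Phi conjugates
  the exchange with lengths nu to the one whose lengths are the masses m of the four intervals, and
  comparing translation parts of return words gives m = P m', where m' belongs to Phi(x/eta). Positive
  backward orbits of P are multiples of nu, so m is one. Then the sup of the deviation of Phi from linearity does
  not change when passing to Phi(x/eta), while the total mass shrinks by 1/eta; so it is 0.
*)
theory Submission
  imports Defs "HOL-Probability.Distribution_Functions"
begin

unbundle no vec_syntax

section \<open>Backward orbits of positive matrices\<close>

text \<open>Q records how T builds S: its columns count the visits to the four intervals of T during
  an excursion from [0, 1]. The second and third letters both start in the second interval of T,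
  which is mapped onto (1, L]; another flip brings them back, and two flips make a translation.
  Flips are the obstacle to a generic argument: a reversed return of an interval that overlaps
  itself has a fixed centre surrounded by periodic points, so minimality has to come from the
  explicit words. Endpoints are treated asymmetrically. Starting points are arbitrary, which forces
  a two-valued relation; targets are taken outside a countable module generated by the lengths,
  where the relation is bijective, and taking closures removes the restriction. On the side of
  measures, masses of intervals could vanish a priori, so the comparison with the exchange of
  lengths m uses only closed inequalities and the algebra of the words.\<close>

lemma stochastic_backward_orbit_constant:
  fixes W :: "'a \<Rightarrow> 'a \<Rightarrow> real" and u :: "nat \<Rightarrow> 'a \<Rightarrow> real"
  assumes I: "finite I" and W: "\<And>i j. i \<in> I \<Longrightarrow> j \<in> I \<Longrightarrow> 0 < W i j"
    and W1: "\<And>i. i \<in> I \<Longrightarrow> (\<Sum>j\<in>I. W i j) = 1"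
    and nonneg: "\<And>n i. i \<in> I \<Longrightarrow> 0 \<le> u n i"
    and rec: "\<And>n i. i \<in> I \<Longrightarrow> u n i = (\<Sum>j\<in>I. W i j * u (Suc n) j)"
  obtains c where "\<And>i. i \<in> I \<Longrightarrow> u 0 i = c"
proof (cases "I = {}")
  case False
  define R where "R = (\<lambda>(n, i). u n i) ` (UNIV \<times> I)"
  define \<alpha> where "\<alpha> = Inf R"
  have R: "R \<noteq> {}" "bdd_below R"
    using False nonneg unfolding R_def by (auto intro!: bdd_belowI[of _ 0])
  have ge: "\<alpha> \<le> u n i" if "i \<in> I" for n i
    unfolding \<alpha>_def using R(2) that by (auto intro!: cInf_lower simp: R_def)
  have shift: "u n i - \<alpha> = (\<Sum>j\<in>I. W i j * (u (Suc n) j - \<alpha>))" if "i \<in> I" for n i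
    using rec[OF that, of n] W1[OF that]
    by (simp add: right_diff_distrib sum_subtractf flip: sum_distrib_right)
  define \<delta> where "\<delta> = Min ((\<lambda>(i, j). W i j) ` (I \<times> I))"
  have \<delta>: "\<delta> \<le> W i j" if "i \<in> I" "j \<in> I" for i j
    unfolding \<delta>_def using I that by (intro Min_le) auto
  have "\<delta> > 0"
    unfolding \<delta>_def using I W False by (subst Min_gr_iff) auto
  have "u 0 i = \<alpha>" if "i \<in> I" for i
  proof (rule ccontr)
    assume "u 0 i \<noteq> \<alpha>"
    define t where "t = u 0 i - \<alpha>"
    have "t > 0" using ge[OF that, of 0] \<open>u 0 i \<noteq> \<alpha>\<close> by (simp add: t_def)
    \<comment> \<open>An average that is at least t has an entry that is at least t, so an excess
      over the infimum survives to every later time.\<close>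
    have large: "\<exists>j\<in>I. t \<le> u n j - \<alpha>" for n
    proof (induction n)
      case (Suc n)
      then obtain j where j: "j \<in> I" "t \<le> u n j - \<alpha>" by blast
      show ?case
      proof (rule ccontr)
        assume "\<not> ?thesis"
        then have "(\<Sum>k\<in>I. W j k * (u (Suc n) k - \<alpha>)) < (\<Sum>k\<in>I. W j k * t)"
          using I False W[OF j(1)] by (intro sum_strict_mono) auto
        also have "\<dots> = t" using W1[OF j(1)] by (simp flip: sum_distrib_right)
        finally show False using shift[OF j(1), of n] j(2) by simp
      qed
    qed (use that t_def in auto)
    \<comment> \<open>All weights are at least \<delta>, so one large entry at the next time lifts
      every entry now. This keeps the whole family away from its own infimum.\<close>
    have "\<alpha> + \<delta> * t \<le> u n k" if "k \<in> I" for n k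
    proof -
      obtain j where j: "j \<in> I" "t \<le> u (Suc n) j - \<alpha>" using large by blast
      have "\<delta> * t \<le> W k j * (u (Suc n) j - \<alpha>)"
        using \<delta>[OF that j(1)] j(2) \<open>\<delta> > 0\<close> \<open>t > 0\<close> by (intro mult_mono) auto
      also have "\<dots> \<le> (\<Sum>j\<in>I. W k j * (u (Suc n) j - \<alpha>))"
      proof (rule member_le_sum[OF j(1) _ I])
        fix l assume "l \<in> I - {j}"
        then show "0 \<le> W k l * (u (Suc n) l - \<alpha>)"
          using W[OF that, of l] ge[of l "Suc n"] by simp
      qed
      finally show ?thesis using shift[OF that, of n] by simp
    qed
    then have "\<alpha> + \<delta> * t \<le> Inf R"
      using R(1) by (intro cInf_greatest) (auto simp: R_def)
    moreover have "0 < \<delta> * t" using \<open>\<delta> > 0\<close> \<open>t > 0\<close> by simp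
    ultimately show False unfolding \<alpha>_def by linarith
  qed
  then show ?thesis using that by blast
qed (use that in auto)

text \<open>Conjugation by the eigenvector and division by the eigenvalue (the Doob transform
  \<open>W\<close>) make A stochastic; the factor \<open>r ^ n\<close> turns the given orbit into a
  backward orbit of \<open>W\<close>.\<close>

lemma positive_backward_orbit:
  fixes A :: "'a \<Rightarrow> 'a \<Rightarrow> real" and m :: "nat \<Rightarrow> 'a \<Rightarrow> real"
  assumes I: "finite I" and A: "\<And>i j. i \<in> I \<Longrightarrow> j \<in> I \<Longrightarrow> 0 < A i j"
    and v: "\<And>i. i \<in> I \<Longrightarrow> 0 < v i" and r: "0 < r"
    and eigen: "\<And>i. i \<in> I \<Longrightarrow> (\<Sum>j\<in>I. A i j * v j) = r * v i"
    and nonneg: "\<And>n i. i \<in> I \<Longrightarrow> 0 \<le> m n i"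
    and rec: "\<And>n i. i \<in> I \<Longrightarrow> m n i = (\<Sum>j\<in>I. A i j * m (Suc n) j)"
  obtains c where "\<And>i. i \<in> I \<Longrightarrow> m 0 i = c * v i"
proof -
  define W where "W = (\<lambda>i j. A i j * v j / (r * v i))"
  define u where "u = (\<lambda>n i. r ^ n * m n i / v i)"
  have 1: "0 < W i j" if "i \<in> I" "j \<in> I" for i j
    using A[OF that] v r that by (simp add: W_def)
  have 2: "(\<Sum>j\<in>I. W i j) = 1" if "i \<in> I" for i
    using eigen[OF that] v[OF that] r by (simp add: W_def flip: sum_divide_distrib)
  have 3: "0 \<le> u n i" if "i \<in> I" for n i
    using nonneg[OF that, of n] v[OF that] r by (simp add: u_def)
  have 4: "u n i = (\<Sum>j\<in>I. W i j * u (Suc n) j)" if "i \<in> I" for n i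
  proof -
    have "u n i = (\<Sum>j\<in>I. r ^ n * (A i j * m (Suc n) j) / v i)"
      unfolding u_def rec[OF that, of n] by (simp add: sum_distrib_left sum_divide_distrib)
    also have "\<dots> = (\<Sum>j\<in>I. W i j * u (Suc n) j)"
      by (rule sum.cong) (use v r in \<open>force simp: W_def u_def\<close>)+
    finally show ?thesis .
  qed
  obtain c where c: "\<And>i. i \<in> I \<Longrightarrow> u 0 i = c"
  proof (rule stochastic_backward_orbit_constant[of I W u])
    show "0 < W i j" if "i \<in> I" "j \<in> I" for i j using 1 that .
    show "(\<Sum>j\<in>I. W i j) = 1" if "i \<in> I" for i using 2 that .
    show "0 \<le> u n i" if "i \<in> I" for n i using 3 that .
    show "u n i = (\<Sum>j\<in>I. W i j * u (Suc n) j)" if "i \<in> I" for n i using 4 that .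
  qed (use I in auto)
  have "m 0 i = c * v i" if "i \<in> I" for i
    using c[OF that] v[OF that] by (simp add: u_def field_simps)
  then show ?thesis using that by blast
qed

lemma sum_less_4: "(\<Sum>i<4. f i) = f 0 + f 1 + f 2 + f (3::nat)" for f :: "nat \<Rightarrow> real"
  by (simp add: eval_nat_numeral)

section \<open>Walks through the branches of a flipped exchange\<close>

text \<open>The closed branches of the exchange of four intervals of lengths \<open>a\<close>, \<open>b\<close>, \<open>c\<close>, \<open>d\<close> with
  image order 3, 4, 1, 2 in which the first and the last interval are flipped. At an interior
  endpoint two branches apply.\<close>
definition branch :: "real \<Rightarrow> real \<Rightarrow> real \<Rightarrow> real \<Rightarrow> nat \<Rightarrow> real \<Rightarrow> real \<Rightarrow> bool" where
  "branch a b c d i x y \<longleftrightarrow>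
     i = 0 \<and> 0 \<le> x \<and> x \<le> a \<and> y = a + c + d - x \<or>
     i = 1 \<and> a \<le> x \<and> x \<le> a + b \<and> y = x + c + d \<or>
     i = 2 \<and> a + b \<le> x \<and> x \<le> a + b + c \<and> y = x - a - b \<or>
     i = 3 \<and> a + b + c \<le> x \<and> x \<le> a + b + c + d \<and> y = a + b + 2 * c + d - x"

primrec walk :: "real \<Rightarrow> real \<Rightarrow> real \<Rightarrow> real \<Rightarrow> nat list \<Rightarrow> real \<Rightarrow> real \<Rightarrow> bool" where
  "walk a b c d [] x y \<longleftrightarrow> x = y"
| "walk a b c d (i # w) x y \<longleftrightarrow> (\<exists>z. branch a b c d i x z \<and> walk a b c d w z y)"

text \<open>Itineraries, until the first return to \<open>[0, 1/\<eta>]\<close>, of the four intervals exchanged there.\<close>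
definition word :: "nat \<Rightarrow> nat list" where
  "word i = [[0, 3, 0, 1, 3, 0, 2],
             [0, 3, 1, 3, 0, 1, 3, 0, 2],
             [0, 3, 1, 3, 0, 1, 3, 0, 2, 0, 3, 1, 3, 0, 2],
             [0, 3, 1, 3, 0, 1, 3, 0, 3, 1, 3, 0, 2]] ! i"

lemma word_nth:
  "word 0 = [0, 3, 0, 1, 3, 0, 2]"
  "word 1 = [0, 3, 1, 3, 0, 1, 3, 0, 2]"
  "word 2 = [0, 3, 1, 3, 0, 1, 3, 0, 2, 0, 3, 1, 3, 0, 2]"
  "word 3 = [0, 3, 1, 3, 0, 1, 3, 0, 3, 1, 3, 0, 2]"
  by (simp_all add: word_def)

text \<open>The intermediate point is already substituted, so a concrete word can be executed letter
  by letter with two linear inequalities for each letter.\<close>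

lemma walk_intros:
  "0 \<le> x \<Longrightarrow> x \<le> a \<Longrightarrow> walk a b c d w (a + c + d - x) y \<Longrightarrow> walk a b c d (0 # w) x y"
  "a \<le> x \<Longrightarrow> x \<le> a + b \<Longrightarrow> walk a b c d w (x + c + d) y \<Longrightarrow> walk a b c d (1 # w) x y"
  "a + b \<le> x \<Longrightarrow> x \<le> a + b + c \<Longrightarrow> walk a b c d w (x - a - b) y \<Longrightarrow> walk a b c d (2 # w) x y"
  "a + b + c \<le> x \<Longrightarrow> x \<le> a + b + c + d \<Longrightarrow> walk a b c d w (a + b + 2 * c + d - x) y
    \<Longrightarrow> walk a b c d (3 # w) x y"
  "x = y \<Longrightarrow> walk a b c d [] x y"
  by (auto simp: branch_def)

lemma word_length: "length (word 0) = 7" "length (word 1) = 9" "length (word 2) = 15" "length (word 3) = 13"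
  by (simp_all add: word_def)

lemma branchI:
  "0 \<le> x \<Longrightarrow> x \<le> a \<Longrightarrow> y = a + c + d - x \<Longrightarrow> branch a b c d 0 x y"
  "a \<le> x \<Longrightarrow> x \<le> a + b \<Longrightarrow> y = x + c + d \<Longrightarrow> branch a b c d 1 x y"
  "a + b \<le> x \<Longrightarrow> x \<le> a + b + c \<Longrightarrow> y = x - a - b \<Longrightarrow> branch a b c d 2 x y"
  "a + b + c \<le> x \<Longrightarrow> x \<le> a + b + c + d \<Longrightarrow> y = a + b + 2 * c + d - x \<Longrightarrow> branch a b c d 3 x y"
  by (auto simp: branch_def)

lemma branch_less_4: "branch a b c d i x y \<Longrightarrow> i < 4"
  by (auto simp: branch_def)

lemma less_4_cases: "i < 4 \<Longrightarrow> i = 0 \<or> i = 1 \<or> i = 2 \<or> i = (3::nat)"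
  by linarith

lemma branch_scale:
  assumes "k > 0"
  shows "branch (k * a) (k * b) (k * c) (k * d) i (k * x) (k * y) \<longleftrightarrow> branch a b c d i x y"
proof -
  have eq: "k * u = v \<longleftrightarrow> u = v / k" for u v
    using assms by (auto simp: field_simps)
  have ord: "0 \<le> k * x \<longleftrightarrow> 0 \<le> x"
    "\<And>u v. k * u \<le> k * v \<longleftrightarrow> u \<le> v"
    "\<And>u v w. k * u \<le> k * v + k * w \<longleftrightarrow> u \<le> v + w"
    "\<And>u v w. k * v + k * w \<le> k * u \<longleftrightarrow> v + w \<le> u"
    "\<And>u v w z. k * u \<le> k * v + k * w + k * z \<longleftrightarrow> u \<le> v + w + z"
    "\<And>u v w z. k * v + k * w + k * z \<le> k * u \<longleftrightarrow> v + w + z \<le> u"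
    "k * x \<le> k * a + k * b + k * c + k * d \<longleftrightarrow> x \<le> a + b + c + d"
    using assms by (simp_all add: zero_le_mult_iff flip: distrib_left)
  have img: "(k * a + k * c + k * d - k * x) / k = a + c + d - x"
    "(k * x + k * c + k * d) / k = x + c + d"
    "(k * x - k * a - k * b) / k = x - a - b"
    "(k * a + k * b + 2 * (k * c) + k * d - k * x) / k = a + b + 2 * c + d - x"
    using assms by (auto simp: field_simps)
  show ?thesis
    unfolding branch_def ord eq img ..
qed

lemma walk_append:
  "walk a b c d (u @ v) x y \<longleftrightarrow> (\<exists>z. walk a b c d u x z \<and> walk a b c d v z y)"
  by (induction u arbitrary: x) auto

lemma branch_diff:
  assumes "branch a b c d i x x'" "branch a b c d i y y'"
  shows "x' - y' = (if i = 1 \<or> i = 2 then 1 else -1) * (x - y)"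
  using assms by (auto simp: branch_def)

text \<open>Every branch is an isometry. With x = y this also shows that a word and its starting
  point determine the end point.\<close>

lemma walk_dist:
  "walk a b c d w x x' \<Longrightarrow> walk a b c d w y y' \<Longrightarrow> \<bar>x' - y'\<bar> = \<bar>x - y\<bar>"
proof (induction w arbitrary: x y)
  case (Cons i w)
  then obtain u v where uv: "branch a b c d i x u" "walk a b c d w u x'"
      "branch a b c d i y v" "walk a b c d w v y'"
    by auto
  show ?case
    using Cons.IH[OF uv(2,4)] branch_diff[OF uv(1,3)] by (auto split: if_splits)
qed auto

lemma walk_drop:
  "walk a b c d (0 # w) x y \<Longrightarrow> walk a b c d w (a + c + d - x) y"
  "walk a b c d (1 # w) x y \<Longrightarrow> walk a b c d w (x + c + d) y"
  "walk a b c d (2 # w) x y \<Longrightarrow> walk a b c d w (x - a - b) y"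
  "walk a b c d (3 # w) x y \<Longrightarrow> walk a b c d w (a + b + 2 * c + d - x) y"
  "walk a b c d [] x y \<Longrightarrow> y = x"
  by (auto simp: branch_def)

definition branch_sign :: "nat \<Rightarrow> real" where
  "branch_sign i = (if i = 1 \<or> i = 2 then 1 else -1)"

text \<open>Parity of the flipped letters 0 and 3 in each word: the induced map reverses exactly the
  intervals that the exchange reverses.\<close>

lemma word_sign: "i < 4 \<Longrightarrow> (\<Prod>k\<leftarrow>word i. branch_sign k) = branch_sign i"
  using less_4_cases[of i] by (auto simp: word_def branch_sign_def)

text \<open>The four lengths are arbitrary here and need not be related by P. The formulas will be
  applied to masses of an invariant measure, for which such a relation is still to be
  derived.\<close>

lemma walk_word_value:
  "walk a b c d (word 0) x y \<Longrightarrow> y = - 3 * b + 2 * d - x"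
  "walk a b c d (word 1) x y \<Longrightarrow> y = - a - 2 * b + c + 2 * d + x"
  "walk a b c d (word 2) x y \<Longrightarrow> y = - 2 * a - 3 * b + 2 * c + 3 * d + x"
  "walk a b c d (word 3) x y \<Longrightarrow> y = c - x"
  unfolding word_nth by (drule walk_drop(1-4) | drule walk_drop(5), linarith)+

section \<open>Lengths in the Perron direction and the towers over the interval of length
  1/\<eta>\<close>

locale perron_direction =
  fixes \<eta> n1 n2 n3 n4 :: real
  assumes pos: "0 < n1" "0 < n2" "0 < n3" "0 < n4"
    and sum1: "n1 + n2 + n3 + n4 = 1"
    and eig: "\<eta> * n1 = 3 * n1 + 3 * n2 + 5 * n3 + 4 * n4"
             "\<eta> * n2 = n1 + 2 * n2 + 3 * n3 + 3 * n4"
             "\<eta> * n3 = n1 + n2 + 2 * n3 + n4"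
             "\<eta> * n4 = 2 * n1 + 3 * n2 + 5 * n3 + 5 * n4"
begin

text \<open>The diagonal entry 3 in the first row of P bounds the eigenvalue from below; in
  particular division by \<eta> is a contraction.\<close>

lemma eta_gt: "\<eta> > 3"
proof -
  have "\<eta> * n1 > 3 * n1" using eig(1) pos by linarith
  then show ?thesis using pos by simp
qed

text \<open>The lengths n are P applied to \<open>t1\<close>, ..., \<open>t4\<close>. Hence every
  position in a tower is an integer combination of these four plus or minus the base point, and
  positions are compared by linear arithmetic with numerals.\<close>

definition t1 where "t1 = n1 / \<eta>"
definition t2 where "t2 = n2 / \<eta>"
definition t3 where "t3 = n3 / \<eta>"
definition t4 where "t4 = n4 / \<eta>"
definition scale where "scale = t1 + t2 + t3 + t4"

lemma t_pos: "0 < t1" "0 < t2" "0 < t3" "0 < t4"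
  using pos eta_gt by (auto simp: t1_def t2_def t3_def t4_def)

lemma eta_t: "\<eta> * t1 = n1" "\<eta> * t2 = n2" "\<eta> * t3 = n3" "\<eta> * t4 = n4"
  using eta_gt by (auto simp: t1_def t2_def t3_def t4_def)

lemma n_eq: "n1 = 3 * t1 + 3 * t2 + 5 * t3 + 4 * t4"
  "n2 = t1 + 2 * t2 + 3 * t3 + 3 * t4"
  "n3 = t1 + t2 + 2 * t3 + t4"
  "n4 = 2 * t1 + 3 * t2 + 5 * t3 + 5 * t4"
  using eig eta_gt by (auto simp: t1_def t2_def t3_def t4_def field_simps)

lemma eta_scale: "\<eta> * scale = 1"
  using eta_t sum1 by (simp add: scale_def distrib_left)

lemmas length_facts = n_eq t_pos scale_def sum1

abbreviation br where "br \<equiv> branch n1 n2 n3 n4"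

lemma br_scaled: "br i (\<eta> * x) (\<eta> * y) \<longleftrightarrow> branch t1 t2 t3 t4 i x y"
  using branch_scale[of \<eta> t1 t2 t3 t4 i x y] eta_gt by (simp add: eta_t)

text \<open>The extra step from 1 to 0 joins the two one-sided images of the second discontinuity. It is
  needed for the relation to renormalize to itself: from the point \<open>1/\<eta>\<close> one may arrive at that
  discontinuity and leave it to 0.\<close>
definition step where "step x y \<longleftrightarrow> (\<exists>i. br i x y) \<or> x = 1 \<and> y = 0"

text \<open>Written in \<open>t1\<close>, ..., \<open>t4\<close>, each intermediate point stays in
  the closed interval of its letter, and the total displacement is that of the small exchange. The
  converse, that no other itinerary occurs apart from the extra step at 1/\<eta>, is
  \<open>first_return\<close>.\<close>

lemma tower_walk:
  assumes "branch t1 t2 t3 t4 i x z"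
  shows "walk n1 n2 n3 n4 (word i) x z"
proof -
  consider "i = 0" "0 \<le> x" "x \<le> t1" "z = t1 + t3 + t4 - x"
   | "i = 1" "t1 \<le> x" "x \<le> t1 + t2" "z = x + t3 + t4"
   | "i = 2" "t1 + t2 \<le> x" "x \<le> t1 + t2 + t3" "z = x - t1 - t2"
   | "i = 3" "t1 + t2 + t3 \<le> x" "x \<le> t1 + t2 + t3 + t4" "z = t1 + t2 + 2 * t3 + t4 - x"
    using assms by (auto simp: branch_def)
  then show ?thesis
  proof cases
    case 1
    show ?thesis
      unfolding \<open>i = 0\<close> word_nth
      by ((rule walk_intros(1-4), (use 1 n_eq t_pos in linarith), (use 1 n_eq t_pos in linarith))+,
          rule walk_intros(5), use 1 n_eq in linarith)
  next
    case 2
    show ?thesis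
      unfolding \<open>i = 1\<close> word_nth
      by ((rule walk_intros(1-4), (use 2 n_eq t_pos in linarith), (use 2 n_eq t_pos in linarith))+,
          rule walk_intros(5), use 2 n_eq in linarith)
  next
    case 3
    show ?thesis
      unfolding \<open>i = 2\<close> word_nth
      by ((rule walk_intros(1-4), (use 3 n_eq t_pos in linarith), (use 3 n_eq t_pos in linarith))+,
          rule walk_intros(5), use 3 n_eq in linarith)
  next
    case 4
    show ?thesis
      unfolding \<open>i = 3\<close> word_nth
      by ((rule walk_intros(1-4), (use 4 n_eq t_pos in linarith), (use 4 n_eq t_pos in linarith))+,
          rule walk_intros(5), use 4 n_eq in linarith)
  qed
qed

text \<open>The successor clause quantifies over all steps, so the base is inevitable and not merely
  attainable, in spite of the two-valued points. The induction rule serves three times: for paths,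
  for the floors of the towers and for the linearity estimate.\<close>

inductive reach :: "real \<Rightarrow> bool" where
  base: "0 \<le> x \<Longrightarrow> x \<le> scale \<Longrightarrow> reach x"
| step: "(\<And>y. step x y \<Longrightarrow> reach y) \<Longrightarrow> reach x"

text \<open>At an interior endpoint both one-sided images have to reach the base. An image 0, which
  the extra step from 1 also produces, lies in the base already.\<close>

lemma reach_from:
  "0 \<le> x \<Longrightarrow> x < n1 \<Longrightarrow> reach (n1 + n3 + n4 - x) \<Longrightarrow> reach x"
  "x = n1 \<Longrightarrow> reach (n3 + n4) \<Longrightarrow> reach (n1 + n3 + n4) \<Longrightarrow> reach x"
  "n1 < x \<Longrightarrow> x < n1 + n2 \<Longrightarrow> reach (x + n3 + n4) \<Longrightarrow> reach x"
  "x = n1 + n2 \<Longrightarrow> reach 1 \<Longrightarrow> reach x"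
  "n1 + n2 < x \<Longrightarrow> x < n1 + n2 + n3 \<Longrightarrow> reach (x - n1 - n2) \<Longrightarrow> reach x"
  "x = n1 + n2 + n3 \<Longrightarrow> reach n3 \<Longrightarrow> reach (n3 + n4) \<Longrightarrow> reach x"
  "n1 + n2 + n3 < x \<Longrightarrow> x \<le> 1 \<Longrightarrow> reach (1 + n3 - x) \<Longrightarrow> reach x"
proof -
  have one: "n1 + n2 + 2 * n3 + n4 = 1 + n3" "n1 + n2 + n3 + n4 = 1"
    using sum1 by auto
  have "reach 0" using t_pos by (intro reach.base) (auto simp: scale_def)
  note p = pos t_pos n_eq
  show "0 \<le> x \<Longrightarrow> x < n1 \<Longrightarrow> reach (n1 + n3 + n4 - x) \<Longrightarrow> reach x"
    using pos sum1 \<open>reach 0\<close> by (intro reach.step[of x]) (auto simp: step_def branch_def one)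
  show "x = n1 \<Longrightarrow> reach (n3 + n4) \<Longrightarrow> reach (n1 + n3 + n4) \<Longrightarrow> reach x"
    using pos sum1 \<open>reach 0\<close> by (intro reach.step[of x]) (auto simp: step_def branch_def one)
  show "n1 < x \<Longrightarrow> x < n1 + n2 \<Longrightarrow> reach (x + n3 + n4) \<Longrightarrow> reach x"
    using pos sum1 \<open>reach 0\<close> by (intro reach.step[of x]) (auto simp: step_def branch_def one)
  show "x = n1 + n2 \<Longrightarrow> reach 1 \<Longrightarrow> reach x"
    using pos sum1 \<open>reach 0\<close> by (intro reach.step[of x]) (auto simp: step_def branch_def one)
  show "n1 + n2 < x \<Longrightarrow> x < n1 + n2 + n3 \<Longrightarrow> reach (x - n1 - n2) \<Longrightarrow> reach x"
    using pos sum1 \<open>reach 0\<close> by (intro reach.step[of x]) (auto simp: step_def branch_def one)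
  show "x = n1 + n2 + n3 \<Longrightarrow> reach n3 \<Longrightarrow> reach (n3 + n4) \<Longrightarrow> reach x"
  proof (rule reach.step)
    fix y assume "x = n1 + n2 + n3" "reach n3" "reach (n3 + n4)" "step x y"
    moreover from this have "y = n3 \<or> y = n3 + n4 \<or> y = 0"
      using pos sum1 unfolding step_def branch_def by auto
    ultimately show "reach y" using \<open>reach 0\<close> by auto
  qed
  show "n1 + n2 + n3 < x \<Longrightarrow> x \<le> 1 \<Longrightarrow> reach (1 + n3 - x) \<Longrightarrow> reach x"
    using pos sum1 \<open>reach 0\<close> by (intro reach.step[of x]) (auto simp: step_def branch_def one)
qed

subsection \<open>Return to the renormalization interval\<close>

lemma reach_all:
  assumes "0 \<le> x" "x \<le> 1"
  shows "reach x"
proof -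
  \<comment> \<open>The first branch sends \<open>\<beta>\<close> to the discontinuity n1 + n2, and
    n4 - n2 to the discontinuity n1 + n2 + n3. Points at most \<open>scale\<close> to the left of
    \<open>\<beta>\<close> are in the base after two steps.\<close>
  define \<beta> where "\<beta> = n3 + n4 - n2"
  note l = length_facts \<beta>_def
  have h1: "reach x" if "\<beta> - scale \<le> x" "x < \<beta>" for x
    by (rule reach_from(1), use that l in linarith, use that l in linarith,
        rule reach_from(5), use that l in linarith, use that l in linarith,
        rule reach.base; use that l in linarith)
  \<comment> \<open>The lower bound equals n2 + n3 + \<open>scale\<close>, the point that
    \<open>scale\<close> reaches in two steps; it is also the bound that keeps the two-step image of
    x below \<open>\<beta>\<close>.\<close>
  have h2: "reach x" if "n1 + 2 * n2 - n4 < x" "x \<le> n3 + n4" for x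
    by (rule reach_from(3), use that l in linarith, use that l in linarith,
        rule reach_from(7), use that l in linarith, use that l in linarith,
        rule h1; use that l in linarith)
  have h3: "reach x" if "scale < x" "x < n4 - n2" for x
    by (rule reach_from(1), use that l in linarith, use that l in linarith,
        rule reach_from(7), use that l in linarith, use that l in linarith,
        rule h2; use that l in linarith)
  have r1: "reach 1"
    by (rule reach_from(7), use l in linarith, use l in linarith, rule h3; use l in linarith)
  have h4: "reach x" if x: "0 \<le> x" "x \<le> \<beta>" for x
  proof -
    consider "x \<le> scale" | "scale < x" "x < n4 - n2" | "x = n4 - n2" | "n4 - n2 < x" "x < \<beta> - scale"
      | "\<beta> - scale \<le> x" "x < \<beta>" | "x = \<beta>"
      using x by linarith
    then show ?thesis
    proof cases
      case 1 then show ?thesis using x by (intro reach.base)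
    next
      case 2 then show ?thesis by (rule h3)
    next
      case 3
      show ?thesis
        by (rule reach_from(1), use 3 l in linarith, use 3 l in linarith,
            rule reach_from(6), use 3 l in linarith, rule h3, use l in linarith, use l in linarith,
            rule h2; use l in linarith)
    next
      case 4
      show ?thesis
        by (rule reach_from(1), use 4 l in linarith, use 4 l in linarith,
            rule reach_from(5), use 4 l in linarith, use 4 l in linarith,
            rule h3; use 4 l in linarith)
    next
      case 5 then show ?thesis by (rule h1)
    next
      case 6
      show ?thesis
        by (rule reach_from(1), use 6 l in linarith, use 6 l in linarith,
            rule reach_from(4), use 6 l in linarith, rule r1)
    qed
  qed
  have h5: "reach x" if "\<beta> < x" "x < n1" for x
    by (rule reach_from(1), use that l in linarith, use that l in linarith,
        rule reach_from(3), use that l in linarith, use that l in linarith,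
        rule reach_from(7), use that l in linarith, use that l in linarith,
        rule h4; use that l in linarith)
  have h6: "reach (n1 + n3 + n4)"
    by (rule reach_from(7), use l in linarith, use l in linarith, rule h5; use l in linarith)
  have h7: "reach x" if "0 \<le> x" "x \<le> n3 + n4" for x
  proof -
    consider "x \<le> \<beta>" | "\<beta> < x" "x < n1" | "x = n1" | "n1 < x" by linarith
    then show ?thesis
    proof cases
      case 1 with that show ?thesis by (intro h4)
    next
      case 2 then show ?thesis by (rule h5)
    next
      case 3
      show ?thesis by (rule reach_from(2), rule 3, rule h2, use l in linarith, use l in linarith, rule h6)
    next
      case 4
      have "reach (1 + n3 - (x + n3 + n4))"
      proof (cases "1 + n3 - (x + n3 + n4) \<le> \<beta>")
        case True
        show ?thesis by (rule h4; use 4 that True l in linarith)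
      next
        case False
        show ?thesis by (rule h5; use 4 that False l in linarith)
      qed
      from reach_from(7)[OF _ _ this] have "reach (x + n3 + n4)"
        using 4 that l by linarith
      from reach_from(3)[OF _ _ this] show ?thesis
        using 4 that l by linarith
    qed
  qed
  have h8: "reach x" if "n1 + n2 + n3 < x" "x \<le> 1" for x
    by (rule reach_from(7), use that in linarith, use that in linarith, rule h7; use that l in linarith)
  consider "x \<le> n1" | "n1 < x" "x < n1 + n2" | "x = n1 + n2" | "n1 + n2 < x" "x < n1 + n2 + n3"
    | "x = n1 + n2 + n3" | "n1 + n2 + n3 < x"
    by linarith
  then show ?thesis
  proof cases
    case 1 show ?thesis by (rule h7; use 1 assms l in linarith)
  next
    case 2 show ?thesis
      by (rule reach_from(3), use 2 in linarith, use 2 in linarith, rule h8; use 2 l in linarith)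
  next
    case 3 then show ?thesis by (rule reach_from(4)) (rule r1)
  next
    case 4 show ?thesis
      by (rule reach_from(5), use 4 in linarith, use 4 in linarith, rule h7; use 4 l in linarith)
  next
    case 5 show ?thesis by (rule reach_from(6), rule 5; rule h7; use l in linarith)
  next
    case 6 with assms show ?thesis by (intro h8)
  qed
qed

lemma step_interior:
  "step x y \<Longrightarrow> x < n1 \<Longrightarrow> br 0 x y \<and> y = n1 + n3 + n4 - x"
  "step x y \<Longrightarrow> n1 < x \<Longrightarrow> x < n1 + n2 \<Longrightarrow> br 1 x y \<and> y = x + n3 + n4"
  "step x y \<Longrightarrow> n1 + n2 < x \<Longrightarrow> x < n1 + n2 + n3 \<Longrightarrow> br 2 x y \<and> y = x - n1 - n2"
  "step x y \<Longrightarrow> n1 + n2 + n3 < x \<Longrightarrow> x < 1 \<Longrightarrow> br 3 x y \<and> y = 1 + n3 - x"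
  using pos sum1 unfolding step_def branch_def by auto

text \<open>For positions that may coincide with an endpoint: the alternatives carry the non-strict
  inequality, or the jump to 0, from which the location of the base point is read off.\<close>

lemma step_tie:
  "step x y \<Longrightarrow> x < n1 + n2 \<Longrightarrow>
    br 0 x y \<and> y = n1 + n3 + n4 - x \<and> x \<le> n1 \<or> br 1 x y \<and> y = x + n3 + n4 \<and> n1 \<le> x"
  "step x y \<Longrightarrow> n1 < x \<Longrightarrow> x < n1 + n2 + n3 \<Longrightarrow> x \<le> n1 + n2 \<Longrightarrow>
    br 1 x y \<and> y = x + n3 + n4 \<or> x = n1 + n2 \<and> y = 0"
  "step x y \<Longrightarrow> n1 + n2 < x \<Longrightarrow> x < 1 \<Longrightarrow>
    br 2 x y \<and> y = x - n1 - n2 \<and> x \<le> n1 + n2 + n3 \<or>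
    br 3 x y \<and> y = 1 + n3 - x \<and> n1 + n2 + n3 \<le> x"
  "step x y \<Longrightarrow> n1 + n2 + n3 < x \<Longrightarrow> br 3 x y \<and> y = 1 + n3 - x \<or> x = 1 \<and> y = 0"
  using pos sum1 unfolding step_def branch_def by auto

definition follows where
  "follows X j w \<longleftrightarrow> (\<forall>k<length w. br (w ! k) (X (j + k)) (X (Suc (j + k))))"

text \<open>The path is forced except at a few times. Position 2 is compared with n1, which
  separates base points at t1; position 8 is compared with n1 + n2 + n3, which separates them at t1
  + t2 + t3; position 9 decides at t1 + t2 whether the base is reached.\<close>

lemma first_return:
  assumes step_path: "\<And>j. step (X j) (X (Suc j))" and X0: "0 \<le> X 0" "X 0 \<le> scale"
  shows "(\<exists>i<4. follows X 0 (word i) \<and> branch t1 t2 t3 t4 i (X 0) (X (length (word i)))) \<or>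
         X 0 = scale \<and> (\<exists>k>0. X k = 0)"
proof -
  note l = length_facts X0
  have p: "step (X 0) (X 1)" "step (X 1) (X 2)" "step (X 2) (X 3)" "step (X 3) (X 4)" "step (X 4) (X 5)"
    "step (X 5) (X 6)" "step (X 6) (X 7)" "step (X 7) (X 8)" "step (X 8) (X 9)" "step (X 9) (X 10)"
    "step (X 10) (X 11)" "step (X 11) (X 12)" "step (X 12) (X 13)" "step (X 13) (X 14)"
    "step (X 14) (X 15)"
    using step_path[of 0] step_path[of 1] step_path[of 2] step_path[of 3] step_path[of 4] step_path[of 5] step_path[of 6] step_path[of 7]
      step_path[of 8] step_path[of 9] step_path[of 10] step_path[of 11] step_path[of 12] step_path[of 13] step_path[of 14]
    by (simp_all add: eval_nat_numeral)
  have r0: "br 0 (X 0) (X 1) \<and> X 1 = n1 + n3 + n4 - X 0"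
    by (rule step_interior(1)[OF p(1)]; use l in linarith)
  note b0 = conjunct1[OF r0]
  have e1: "X 1 = 6 * t1 + 7 * t2 + 12 * t3 + 10 * t4 - X 0"
    using conjunct2[OF r0] l by linarith
  have r1: "br 3 (X 1) (X 2) \<and> X 2 = 1 + n3 - X 1"
    by (rule step_interior(4)[OF p(2)]; use l e1 in linarith)
  note b1 = conjunct1[OF r1]
  have e2: "X 2 = X 0 + 2 * t1 + 3 * t2 + 5 * t3 + 4 * t4"
    using conjunct2[OF r1] l e1 by linarith
  have "br 0 (X 2) (X 3) \<and> X 3 = n1 + n3 + n4 - X 2 \<and> X 2 \<le> n1
      \<or> br 1 (X 2) (X 3) \<and> X 3 = X 2 + n3 + n4 \<and> n1 \<le> X 2"
    by (rule step_tie(1)[OF p(3)]; use l e2 in linarith)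
  then show ?thesis
  proof (elim disjE conjE)
    assume b2: "br 0 (X 2) (X 3)" and a2: "X 3 = n1 + n3 + n4 - X 2" "X 2 \<le> n1"
    have e3: "X 3 = 4 * t1 + 4 * t2 + 7 * t3 + 6 * t4 - X 0" and c2: "X 0 \<le> t1"
      using a2 l e2 by linarith+
    have r3: "br 1 (X 3) (X 4) \<and> X 4 = X 3 + n3 + n4"
      by (rule step_interior(2)[OF p(4)]; use l e3 c2 in linarith)
    note b3 = conjunct1[OF r3]
    have e4: "X 4 = 7 * t1 + 8 * t2 + 14 * t3 + 12 * t4 - X 0"
      using conjunct2[OF r3] l e3 by linarith
    have r4: "br 3 (X 4) (X 5) \<and> X 5 = 1 + n3 - X 4"
      by (rule step_interior(4)[OF p(5)]; use l e4 c2 in linarith)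
    note b4 = conjunct1[OF r4]
    have e5: "X 5 = X 0 + t1 + 2 * t2 + 3 * t3 + 2 * t4"
      using conjunct2[OF r4] l e4 by linarith
    have r5: "br 0 (X 5) (X 6) \<and> X 6 = n1 + n3 + n4 - X 5"
      by (rule step_interior(1)[OF p(6)]; use l e5 c2 in linarith)
    note b5 = conjunct1[OF r5]
    have e6: "X 6 = 5 * t1 + 5 * t2 + 9 * t3 + 8 * t4 - X 0"
      using conjunct2[OF r5] l e5 by linarith
    have r6: "br 2 (X 6) (X 7) \<and> X 7 = X 6 - n1 - n2"
      by (rule step_interior(3)[OF p(7)]; use l e6 c2 in linarith)
    note b6 = conjunct1[OF r6]
    have e7: "X 7 = t1 + t3 + t4 - X 0"
      using conjunct2[OF r6] l e6 by linarith
    have "follows X 0 (word 0)"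
      using b0 b1 b2 b3 b4 b5 b6
      unfolding follows_def word_nth by (simp add: All_less_Suc numeral_nat)
    moreover have "branch t1 t2 t3 t4 0 (X 0) (X (length (word 0)))"
      unfolding word_length by (rule branchI(1); use l e7 c2 in linarith)
    ultimately show ?thesis by (intro disjI1 exI[of _ 0]) simp
  next
    assume b2: "br 1 (X 2) (X 3)" and a2: "X 3 = X 2 + n3 + n4" "n1 \<le> X 2"
    have e3: "X 3 = X 0 + 5 * t1 + 7 * t2 + 12 * t3 + 10 * t4" and c2: "t1 \<le> X 0"
      using a2 l e2 by linarith+
    have r3: "br 3 (X 3) (X 4) \<and> X 4 = 1 + n3 - X 3"
      by (rule step_interior(4)[OF p(4)]; use l e3 c2 in linarith)
    note b3 = conjunct1[OF r3]
    have e4: "X 4 = 3 * t1 + 3 * t2 + 5 * t3 + 4 * t4 - X 0"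
      using conjunct2[OF r3] l e3 by linarith
    have r4: "br 0 (X 4) (X 5) \<and> X 5 = n1 + n3 + n4 - X 4"
      by (rule step_interior(1)[OF p(5)]; use l e4 c2 in linarith)
    note b4 = conjunct1[OF r4]
    have e5: "X 5 = X 0 + 3 * t1 + 4 * t2 + 7 * t3 + 6 * t4"
      using conjunct2[OF r4] l e4 by linarith
    show ?thesis
    \<comment> \<open>Position 5 is the discontinuity n1 + n2 exactly when X 0 =
      \<open>scale\<close>. From there 0 is reached at time 6 by the third branch or at time 7 by
      way of 1; after rescaling, this is the extra step from 1 to 0.\<close>
    proof (cases "X 0 = scale \<and> (X 6 = 0 \<or> X 7 = 0)")
      case True
      then show ?thesis by (auto intro: exI[of _ 6] exI[of _ 7])
    next
      case no_hat: False
      have "br 1 (X 5) (X 6) \<and> X 6 = X 5 + n3 + n4 \<or> X 5 = n1 + n2 \<and> X 6 = 0"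
        by (rule step_tie(2)[OF p(6)]; use l e5 c2 in linarith)
      moreover have "X 0 = scale" if "X 5 = n1 + n2"
        using that l e5 by linarith
      ultimately have b5: "br 1 (X 5) (X 6)" and "X 6 = X 5 + n3 + n4"
        using no_hat by blast+
      then have e6: "X 6 = X 0 + 6 * t1 + 8 * t2 + 14 * t3 + 12 * t4"
        using e5 l by linarith
      have "br 3 (X 6) (X 7) \<and> X 7 = 1 + n3 - X 6 \<or> X 6 = 1 \<and> X 7 = 0"
        by (rule step_tie(4)[OF p(7)]; use l e6 c2 in linarith)
      moreover have "X 0 = scale" if "X 6 = 1"
        using that l e6 by linarith
      ultimately have b6: "br 3 (X 6) (X 7)" and "X 7 = 1 + n3 - X 6"
        using no_hat by blast+
      then have e7: "X 7 = 2 * t1 + 2 * t2 + 3 * t3 + 2 * t4 - X 0"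
        using e6 l by linarith
      have r7: "br 0 (X 7) (X 8) \<and> X 8 = n1 + n3 + n4 - X 7"
        by (rule step_interior(1)[OF p(8)]; use l e7 c2 in linarith)
      note b7 = conjunct1[OF r7]
      have e8: "X 8 = X 0 + 4 * t1 + 5 * t2 + 9 * t3 + 8 * t4"
        using conjunct2[OF r7] l e7 by linarith
      have "br 2 (X 8) (X 9) \<and> X 9 = X 8 - n1 - n2 \<and> X 8 \<le> n1 + n2 + n3
          \<or> br 3 (X 8) (X 9) \<and> X 9 = 1 + n3 - X 8 \<and> n1 + n2 + n3 \<le> X 8"
        by (rule step_tie(3)[OF p(9)]; use l e8 in linarith)
      then show ?thesis
      proof (elim disjE conjE)
        assume b8: "br 2 (X 8) (X 9)" and a8: "X 9 = X 8 - n1 - n2" "X 8 \<le> n1 + n2 + n3"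
        have e9: "X 9 = X 0 + t3 + t4" and c8: "X 0 \<le> t1 + t2 + t3"
          using a8 l e8 by linarith+
        show ?thesis
        \<comment> \<open>No discontinuity is involved: X 9 = X 0 + t3 + t4 is in the base precisely
          in this case. Otherwise the itinerary continues, which is why \<open>word 2\<close>
          extends \<open>word 1\<close>.\<close>
        proof (cases "X 0 \<le> t1 + t2")
          case c9: True
          have "follows X 0 (word 1)"
            using b0 b1 b2 b3 b4 b5 b6 b7 b8
            unfolding follows_def word_nth by (simp add: All_less_Suc numeral_nat)
          moreover have "branch t1 t2 t3 t4 1 (X 0) (X (length (word 1)))"
            unfolding word_length by (rule branchI(2); use l e9 c2 c9 in linarith)
          ultimately show ?thesis by (intro disjI1 exI[of _ 1]) simp
        next
          case c9: False
          have r9: "br 0 (X 9) (X 10) \<and> X 10 = n1 + n3 + n4 - X 9"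
            by (rule step_interior(1)[OF p(10)]; use l e9 c8 c9 in linarith)
          note b9 = conjunct1[OF r9]
          have e10: "X 10 = 6 * t1 + 7 * t2 + 11 * t3 + 9 * t4 - X 0"
            using conjunct2[OF r9] l e9 by linarith
          have r10: "br 3 (X 10) (X 11) \<and> X 11 = 1 + n3 - X 10"
            by (rule step_interior(4)[OF p(11)]; use l e10 c8 c9 in linarith)
          note b10 = conjunct1[OF r10]
          have e11: "X 11 = X 0 + 2 * t1 + 3 * t2 + 6 * t3 + 5 * t4"
            using conjunct2[OF r10] l e10 by linarith
          have r11: "br 1 (X 11) (X 12) \<and> X 12 = X 11 + n3 + n4"
            by (rule step_interior(2)[OF p(12)]; use l e11 c8 c9 in linarith)
          note b11 = conjunct1[OF r11]
          have e12: "X 12 = X 0 + 5 * t1 + 7 * t2 + 13 * t3 + 11 * t4"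
            using conjunct2[OF r11] l e11 by linarith
          have r12: "br 3 (X 12) (X 13) \<and> X 13 = 1 + n3 - X 12"
            by (rule step_interior(4)[OF p(13)]; use l e12 c8 c9 in linarith)
          note b12 = conjunct1[OF r12]
          have e13: "X 13 = 3 * t1 + 3 * t2 + 4 * t3 + 3 * t4 - X 0"
            using conjunct2[OF r12] l e12 by linarith
          have r13: "br 0 (X 13) (X 14) \<and> X 14 = n1 + n3 + n4 - X 13"
            by (rule step_interior(1)[OF p(14)]; use l e13 c8 c9 in linarith)
          note b13 = conjunct1[OF r13]
          have e14: "X 14 = X 0 + 3 * t1 + 4 * t2 + 8 * t3 + 7 * t4"
            using conjunct2[OF r13] l e13 by linarith
          have r14: "br 2 (X 14) (X 15) \<and> X 15 = X 14 - n1 - n2"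
            by (rule step_interior(3)[OF p(15)]; use l e14 c8 c9 in linarith)
          note b14 = conjunct1[OF r14]
          have e15: "X 15 = X 0 - t1 - t2"
            using conjunct2[OF r14] l e14 by linarith
          have "follows X 0 (word 2)"
            using b0 b1 b2 b3 b4 b5 b6 b7 b8 b9 b10 b11 b12 b13 b14
            unfolding follows_def word_nth by (simp add: All_less_Suc numeral_nat)
          moreover have "branch t1 t2 t3 t4 2 (X 0) (X (length (word 2)))"
            unfolding word_length by (rule branchI(3); use l e15 c8 c9 in linarith)
          ultimately show ?thesis by (intro disjI1 exI[of _ 2]) simp
        qed
      next
        assume b8: "br 3 (X 8) (X 9)" and a8: "X 9 = 1 + n3 - X 8" "n1 + n2 + n3 \<le> X 8"
        have e9: "X 9 = 4 * t1 + 5 * t2 + 8 * t3 + 6 * t4 - X 0" and c8: "t1 + t2 + t3 \<le> X 0"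
          using a8 l e8 by linarith+
        have r9: "br 1 (X 9) (X 10) \<and> X 10 = X 9 + n3 + n4"
          by (rule step_interior(2)[OF p(10)]; use l e9 c8 in linarith)
        note b9 = conjunct1[OF r9]
        have e10: "X 10 = 7 * t1 + 9 * t2 + 15 * t3 + 12 * t4 - X 0"
          using conjunct2[OF r9] l e9 by linarith
        have r10: "br 3 (X 10) (X 11) \<and> X 11 = 1 + n3 - X 10"
          by (rule step_interior(4)[OF p(11)]; use l e10 c8 in linarith)
        note b10 = conjunct1[OF r10]
        have e11: "X 11 = X 0 + t1 + t2 + 2 * t3 + 2 * t4"
          using conjunct2[OF r10] l e10 by linarith
        have r11: "br 0 (X 11) (X 12) \<and> X 12 = n1 + n3 + n4 - X 11"
          by (rule step_interior(1)[OF p(12)]; use l e11 c8 in linarith)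
        note b11 = conjunct1[OF r11]
        have e12: "X 12 = 5 * t1 + 6 * t2 + 10 * t3 + 8 * t4 - X 0"
          using conjunct2[OF r11] l e11 by linarith
        have r12: "br 2 (X 12) (X 13) \<and> X 13 = X 12 - n1 - n2"
          by (rule step_interior(3)[OF p(13)]; use l e12 c8 in linarith)
        note b12 = conjunct1[OF r12]
        have e13: "X 13 = t1 + t2 + 2 * t3 + t4 - X 0"
          using conjunct2[OF r12] l e12 by linarith
        have "follows X 0 (word 3)"
          using b0 b1 b2 b3 b4 b5 b6 b7 b8 b9 b10 b11 b12
          unfolding follows_def word_nth by (simp add: All_less_Suc numeral_nat)
        moreover have "branch t1 t2 t3 t4 3 (X 0) (X (length (word 3)))"
          unfolding word_length by (rule branchI(4); use l e13 c8 in linarith)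
        ultimately show ?thesis by (intro disjI1 exI[of _ 3]) simp
      qed
    qed
  qed
qed

subsection \<open>Density of paths\<close>

text \<open>Orbits of points outside the following countable group stay outside it and never meet an
  endpoint, at any level of the renormalization.\<close>
definition length_span :: "real set" where
  "length_span = {x. \<exists>(a::int) (b::int) (c::int) (d::int). x = a * n1 + b * n2 + c * n3 + d * n4}"

definition endpoint_module :: "real set" where
  "endpoint_module = {x. \<exists>k::nat. x * \<eta> ^ k \<in> length_span}"

section \<open>Generic points: the complement of a countable module stable under rescaling\<close>

lemma length_span_diff: "x \<in> length_span \<Longrightarrow> y \<in> length_span \<Longrightarrow> x - y \<in> length_span"
proof -
  assume "x \<in> length_span" "y \<in> length_span"
  then obtain a b c d a' b' c' d' :: int where
    "x = a * n1 + b * n2 + c * n3 + d * n4" "y = a' * n1 + b' * n2 + c' * n3 + d' * n4"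
    unfolding length_span_def by blast
  then have "x - y = (a - a') * n1 + (b - b') * n2 + (c - c') * n3 + (d - d') * n4"
    by (simp add: algebra_simps)
  then have "x - y = of_int (a - a') * n1 + of_int (b - b') * n2 + of_int (c - c') * n3 + of_int (d - d') * n4"
    by simp
  then show ?thesis unfolding length_span_def by blast
qed

lemma length_span_basis: "n1 \<in> length_span" "n2 \<in> length_span" "n3 \<in> length_span" "n4 \<in> length_span" "0 \<in> length_span"
proof -
  have "a * n1 + b * n2 + c * n3 + d * n4 \<in> length_span" for a b c d :: int
    unfolding length_span_def by blast
  from this[of 1 0 0 0] this[of 0 1 0 0] this[of 0 0 1 0] this[of 0 0 0 1] this[of 0 0 0 0]
  show "n1 \<in> length_span" "n2 \<in> length_span" "n3 \<in> length_span" "n4 \<in> length_span" "0 \<in> length_span" by simp_all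
qed

text \<open>P is an integer matrix, so \<eta> maps the group generated by the lengths into itself;
  the transpose of P acts on the coefficients.\<close>

lemma length_span_eta: "x \<in> length_span \<Longrightarrow> x * \<eta> ^ k \<in> length_span"
proof (induction k)
  case (Suc k)
  then obtain a b c d :: int where x: "x * \<eta> ^ k = a * n1 + b * n2 + c * n3 + d * n4"
    unfolding length_span_def by blast
  have "x * \<eta> ^ Suc k = \<eta> * (a * n1 + b * n2 + c * n3 + d * n4)"
    using x by simp
  also have "\<dots> = a * (\<eta> * n1) + b * (\<eta> * n2) + c * (\<eta> * n3) + d * (\<eta> * n4)"
    by (simp add: algebra_simps)
  also have "\<dots> = of_int (3 * a + b + c + 2 * d) * n1 + of_int (3 * a + 2 * b + c + 3 * d) * n2 +
      of_int (5 * a + 3 * b + 2 * c + 5 * d) * n3 + of_int (4 * a + 3 * b + c + 5 * d) * n4"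
    unfolding eig by (simp add: algebra_simps)
  finally show ?case unfolding length_span_def by blast
qed auto

lemma endpoint_module_diff: "x \<in> endpoint_module \<Longrightarrow> y \<in> endpoint_module \<Longrightarrow> x - y \<in> endpoint_module"
proof -
  assume "x \<in> endpoint_module" "y \<in> endpoint_module"
  then obtain k m where "x * \<eta> ^ k \<in> length_span" "y * \<eta> ^ m \<in> length_span"
    unfolding endpoint_module_def by blast
  then have "(x * \<eta> ^ k) * \<eta> ^ m - (y * \<eta> ^ m) * \<eta> ^ k \<in> length_span"
    by (rule length_span_diff[OF length_span_eta length_span_eta])
  then have "(x - y) * \<eta> ^ (k + m) \<in> length_span"
    by (simp add: power_add algebra_simps)
  then show ?thesis unfolding endpoint_module_def by blast
qed

lemma endpoint_module_basis: "n1 \<in> endpoint_module" "n2 \<in> endpoint_module" "n3 \<in> endpoint_module" "n4 \<in> endpoint_module" "0 \<in> endpoint_module"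
proof -
  have "length_span \<subseteq> endpoint_module" unfolding endpoint_module_def by (auto intro!: exI[of _ 0])
  then show "n1 \<in> endpoint_module" "n2 \<in> endpoint_module" "n3 \<in> endpoint_module" "n4 \<in> endpoint_module" "0 \<in> endpoint_module" using length_span_basis by auto
qed

lemma endpoint_module_add: "x \<in> endpoint_module \<Longrightarrow> y \<in> endpoint_module \<Longrightarrow> x + y \<in> endpoint_module"
  using endpoint_module_diff[of x "0 - y"] endpoint_module_diff[OF endpoint_module_basis(5)] by simp

lemma endpoint_module_diff_iff: "c \<in> endpoint_module \<Longrightarrow> c - x \<in> endpoint_module \<longleftrightarrow> x \<in> endpoint_module"
  using endpoint_module_diff[of c x] endpoint_module_diff[of c "c - x"] by auto

lemma endpoint_module_add_iff: "c \<in> endpoint_module \<Longrightarrow> x + c \<in> endpoint_module \<longleftrightarrow> x \<in> endpoint_module" "c \<in> endpoint_module \<Longrightarrow> x - c \<in> endpoint_module \<longleftrightarrow> x \<in> endpoint_module"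
proof -
  show "x + c \<in> endpoint_module \<longleftrightarrow> x \<in> endpoint_module" if "c \<in> endpoint_module"
    using endpoint_module_add[OF _ that, of x] endpoint_module_diff[OF _ that, of "x + c"] by (simp only: add_diff_cancel_right') blast
  show "x - c \<in> endpoint_module \<longleftrightarrow> x \<in> endpoint_module" if "c \<in> endpoint_module"
    using endpoint_module_diff[OF _ that, of x] endpoint_module_add[OF _ that, of "x - c"] by (simp only: diff_add_cancel) blast
qed

lemma endpoint_module_1: "1 \<in> endpoint_module"
  using endpoint_module_add[OF endpoint_module_add[OF endpoint_module_add[OF endpoint_module_basis(1,2)] endpoint_module_basis(3)] endpoint_module_basis(4)] sum1 by simp

text \<open>Powers of \<eta> are allowed as denominators so that rescaling in either direction
  preserves membership; generic points then stay generic at every level of the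
  renormalization.\<close>

lemma endpoint_module_eta: "\<eta> * x \<in> endpoint_module \<longleftrightarrow> x \<in> endpoint_module"
proof
  assume "\<eta> * x \<in> endpoint_module"
  then obtain k where "(\<eta> * x) * \<eta> ^ k \<in> length_span" unfolding endpoint_module_def by blast
  then have "x * \<eta> ^ Suc k \<in> length_span" by (simp add: mult.assoc mult.left_commute)
  then show "x \<in> endpoint_module" unfolding endpoint_module_def by blast
next
  assume "x \<in> endpoint_module"
  then obtain k where "x * \<eta> ^ k \<in> length_span" unfolding endpoint_module_def by blast
  from length_span_eta[OF this, of 1] have "(\<eta> * x) * \<eta> ^ k \<in> length_span"
    by (simp add: mult.assoc mult.left_commute mult.commute)
  then show "\<eta> * x \<in> endpoint_module" unfolding endpoint_module_def by blast
qed

lemma countable_endpoint_module: "countable endpoint_module"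
proof -
  define f where "f = (\<lambda>(k::nat, a::int, b::int, c::int, d::int). (a * n1 + b * n2 + c * n3 + d * n4) / \<eta> ^ k)"
  have "endpoint_module \<subseteq> range f"
  proof
    fix x assume "x \<in> endpoint_module"
    then obtain k a b c d where "x * \<eta> ^ k = of_int a * n1 + of_int b * n2 + of_int c * n3 + of_int d * n4"
      unfolding endpoint_module_def length_span_def by blast
    then have "x = f (k, a, b, c, d)"
      unfolding f_def using eta_gt by (simp add: field_simps)
    then show "x \<in> range f" by blast
  qed
  then show ?thesis by (rule countable_subset) simp
qed

lemma endpoint_module_codense: "a < b \<Longrightarrow> \<exists>y. y \<notin> endpoint_module \<and> a < y \<and> y < b"
proof (rule ccontr)
  assume "a < b" "\<nexists>y. y \<notin> endpoint_module \<and> a < y \<and> y < b"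
  then have "{a<..<b} \<subseteq> endpoint_module" by auto
  with countable_endpoint_module have "countable {a<..<b}" by (rule countable_subset[rotated])
  then show False using \<open>a < b\<close> uncountable_open_interval by blast
qed

lemma br_endpoint_module: "br i x y \<Longrightarrow> x \<in> endpoint_module \<longleftrightarrow> y \<in> endpoint_module"
proof -
  have c: "n1 + n3 + n4 \<in> endpoint_module" "n3 + n4 \<in> endpoint_module" "n1 + n2 \<in> endpoint_module" "n1 + n2 + 2 * n3 + n4 \<in> endpoint_module"
    unfolding mult_2 by (intro endpoint_module_add endpoint_module_basis)+
  assume "br i x y"
  then consider "y = n1 + n3 + n4 - x" | "y = x + (n3 + n4)" | "y = x - (n1 + n2)"
    | "y = n1 + n2 + 2 * n3 + n4 - x"
    by (auto simp: branch_def)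
  then show ?thesis
    by cases (simp_all only: endpoint_module_diff_iff[OF c(1)] endpoint_module_add_iff(1)[OF c(2)] endpoint_module_add_iff(2)[OF c(3)]
        endpoint_module_diff_iff[OF c(4)])
qed

lemma scaled_endpoint_module: "branch t1 t2 t3 t4 i x y \<Longrightarrow> x \<in> endpoint_module \<longleftrightarrow> y \<in> endpoint_module"
  using br_endpoint_module[of i "\<eta> * x" "\<eta> * y"] by (simp add: br_scaled endpoint_module_eta)

lemma br_index:
  "br i x y \<Longrightarrow> x < n1 \<Longrightarrow> i = 0"
  "br i x y \<Longrightarrow> n1 < x \<Longrightarrow> x < n1 + n2 \<Longrightarrow> i = 1"
  "br i x y \<Longrightarrow> n1 + n2 < x \<Longrightarrow> x < n1 + n2 + n3 \<Longrightarrow> i = 2"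
  "br i x y \<Longrightarrow> n1 + n2 + n3 < x \<Longrightarrow> i = 3"
  using pos unfolding branch_def by auto

lemma br_unique:
  assumes "x \<notin> endpoint_module" "br i x y" "br j x z" shows "i = j"
proof -
  have "n1 + n2 \<in> endpoint_module" "n1 + n2 + n3 \<in> endpoint_module" by (intro endpoint_module_add endpoint_module_basis)+
  with assms(1) endpoint_module_basis have "x \<noteq> n1" "x \<noteq> n1 + n2" "x \<noteq> n1 + n2 + n3" by auto
  then consider "x < n1" | "n1 < x" "x < n1 + n2" | "n1 + n2 < x" "x < n1 + n2 + n3" | "n1 + n2 + n3 < x"
    by linarith
  then show ?thesis
    by cases (use br_index[OF assms(2)] br_index[OF assms(3)] in simp_all)
qed

text \<open>The images lie in the order 3, 4, 1, 2, whence the cuts n3, n3 + n4 and n1 + n3 +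
  n4.\<close>

lemma br_preimage:
  "br i x y \<Longrightarrow> y < n3 \<Longrightarrow> x = y + n1 + n2"
  "br i x y \<Longrightarrow> n3 < y \<Longrightarrow> y < n3 + n4 \<Longrightarrow> x = n1 + n2 + 2 * n3 + n4 - y"
  "br i x y \<Longrightarrow> n3 + n4 < y \<Longrightarrow> y < n1 + n3 + n4 \<Longrightarrow> x = n1 + n3 + n4 - y"
  "br i x y \<Longrightarrow> n1 + n3 + n4 < y \<Longrightarrow> x = y - n3 - n4"
  using pos unfolding branch_def by auto

lemma br_inj:
  assumes "y \<notin> endpoint_module" "br i x y" "br j z y" shows "x = z"
proof -
  have "n3 + n4 \<in> endpoint_module" "n1 + n3 + n4 \<in> endpoint_module" by (intro endpoint_module_add endpoint_module_basis)+
  with assms(1) endpoint_module_basis have "y \<noteq> n3" "y \<noteq> n3 + n4" "y \<noteq> n1 + n3 + n4" by auto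
  then consider "y < n3" | "n3 < y" "y < n3 + n4" | "n3 + n4 < y" "y < n1 + n3 + n4" | "n1 + n3 + n4 < y"
    by linarith
  then show ?thesis
    by cases (use br_preimage[OF assms(2)] br_preimage[OF assms(3)] in simp_all)
qed

lemma br_dom: "0 \<le> x \<Longrightarrow> x \<le> 1 \<Longrightarrow> \<exists>i y. br i x y"
proof -
  assume "0 \<le> x" "x \<le> 1"
  then consider "x \<le> n1" | "n1 \<le> x" "x \<le> n1 + n2" | "n1 + n2 \<le> x" "x \<le> n1 + n2 + n3"
    | "n1 + n2 + n3 \<le> x" by linarith
  then show ?thesis
  proof cases
    case 1
    then show ?thesis using \<open>0 \<le> x\<close> branchI(1)[OF _ _ refl] by blast
  next
    case 2
    then show ?thesis using branchI(2)[OF _ _ refl] by blast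
  next
    case 3
    then show ?thesis using branchI(3)[OF _ _ refl] by blast
  next
    case 4
    then show ?thesis using \<open>x \<le> 1\<close> sum1 branchI(4)[OF _ _ refl, of n1 n2 n3 x n4] by auto
  qed
qed

lemma br_surj: "0 \<le> y \<Longrightarrow> y \<le> 1 \<Longrightarrow> \<exists>i x. br i x y"
proof -
  assume y: "0 \<le> y" "y \<le> 1"
  then consider "y \<le> n3" | "n3 \<le> y" "y \<le> n3 + n4" | "n3 + n4 \<le> y" "y \<le> n1 + n3 + n4"
    | "n1 + n3 + n4 \<le> y" by linarith
  then show ?thesis
  proof cases
    case 1
    then have "br 2 (y + n1 + n2) y" using y pos by (simp add: branch_def)
    then show ?thesis by blast
  next
    case 2
    then have "br 3 (n1 + n2 + 2 * n3 + n4 - y) y" using y pos by (simp add: branch_def)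
    then show ?thesis by blast
  next
    case 3
    then have "br 0 (n1 + n3 + n4 - y) y" using y pos by (simp add: branch_def)
    then show ?thesis by blast
  next
    case 4
    then have "br 1 (y - n3 - n4) y" using y pos sum1 by (simp add: branch_def)
    then show ?thesis by blast
  qed
qed

lemma br_range: "br i x y \<Longrightarrow> 0 \<le> x \<and> x \<le> 1 \<and> 0 \<le> y \<and> y \<le> 1"
  using pos sum1 unfolding branch_def by auto

text \<open>Floor k of the i-th tower, over a base point x that is itself generic, as the induction
  on the level requires; z witnesses that x lies in the i-th small interval.\<close>

definition on_floor where
  "on_floor y \<longleftrightarrow> (\<exists>i k x z. i < 4 \<and> k < length (word i) \<and> x \<notin> endpoint_module \<and> branch t1 t2 t3 t4 i x z \<and>
     walk n1 n2 n3 n4 (take k (word i)) x y)"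

lemma word_nonempty: "i < 4 \<Longrightarrow> word i \<noteq> []"
  using less_4_cases[of i] by (auto simp: word_def)

text \<open>Floors are followed backwards: by induction the successor of y lies on a floor, and
  injectivity off the endpoints puts y one floor lower.\<close>

lemma floor_cover: "reach y \<Longrightarrow> 0 \<le> y \<Longrightarrow> y \<le> 1 \<Longrightarrow> y \<notin> endpoint_module \<Longrightarrow> on_floor y"
proof (induction rule: reach.induct)
  case (base y)
  then have "0 \<le> \<eta> * y" "\<eta> * y \<le> 1"
    using eta_gt eta_scale mult_left_mono[of y scale \<eta>] by auto
  then obtain i u where i: "br i (\<eta> * y) u" using br_dom by blast
  then have "branch t1 t2 t3 t4 i y (u / \<eta>)"
    using br_scaled[of i y "u / \<eta>"] eta_gt by simp
  moreover have "walk n1 n2 n3 n4 (take 0 (word i)) y y" by simp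
  moreover have "0 < length (word i)"
    using word_nonempty[OF branch_less_4[OF i]] by simp
  ultimately show ?case
    unfolding on_floor_def using branch_less_4[OF i] base.prems(3) by blast
next
  case (step y)
  obtain b v where b: "br b y v" using br_dom step.prems by blast
  then have v: "v \<notin> endpoint_module" using br_endpoint_module step.prems by blast
  have "step y v" using b unfolding step_def by blast
  with step.IH br_range[OF b] v have "on_floor v" by blast
  then obtain i k x z where f: "i < 4" "k < length (word i)" "x \<notin> endpoint_module" "branch t1 t2 t3 t4 i x z"
     "walk n1 n2 n3 n4 (take k (word i)) x v"
    unfolding on_floor_def by blast
  show ?case
  proof (cases k)
    case (Suc m)
    then have "take k (word i) = take m (word i) @ [word i ! m]"
      using f(2) by (simp add: take_Suc_conv_app_nth)
    with f(5) obtain y' where y': "walk n1 n2 n3 n4 (take m (word i)) x y'" "br (word i ! m) y' v"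
      by (auto simp: walk_append)
    have "walk n1 n2 n3 n4 (take m (word i)) x y"
      using y'(1) br_inj[OF v y'(2) b] by simp
    moreover have "m < length (word i)" using f(2) Suc by simp
    ultimately show ?thesis
      unfolding on_floor_def using f(1,3,4) by blast
  next
    case 0
    then have [simp]: "v = x" using f(5) by simp
    \<comment> \<open>The successor of y is a base point, so y is on the top floor of the tower over
      its preimage under the small exchange, which exists by surjectivity.\<close>
    have "br i (\<eta> * x) (\<eta> * z)" using f(4) by (simp add: br_scaled)
    from br_range[OF this] obtain j u where u: "br j u (\<eta> * x)" using br_surj by blast
    then have c: "branch t1 t2 t3 t4 j (u / \<eta>) x"
      using br_scaled[of j "u / \<eta>" x] eta_gt by simp
    note j = branch_less_4[OF u]
    define m where "m = length (word j) - 1"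
    have m: "m < length (word j)" "Suc m = length (word j)"
      using word_nonempty[OF j] by (auto simp: m_def)
    have "take m (word j) @ [word j ! m] = word j"
      using take_Suc_conv_app_nth[OF m(1)] m(2) by simp
    then have "walk n1 n2 n3 n4 (take m (word j) @ [word j ! m]) (u / \<eta>) x"
      using tower_walk[OF c] by (simp only:)
    then obtain y' where
      y': "walk n1 n2 n3 n4 (take m (word j)) (u / \<eta>) y'" "br (word j ! m) y' x"
      by (auto simp: walk_append)
    have "walk n1 n2 n3 n4 (take m (word j)) (u / \<eta>) y"
      using y'(1) br_inj[OF f(3) y'(2)] b by simp
    moreover have "u / \<eta> \<notin> endpoint_module" using scaled_endpoint_module[OF c] f(3) by blast
    ultimately show ?thesis
      unfolding on_floor_def using j c m(1) by blast
  qed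
qed

section \<open>Infinite paths and the paths formed by their returns\<close>

definition step_path where "step_path X \<longleftrightarrow> (\<forall>j. step (X j) (X (Suc j)))"

lemma step_range: "step x y \<Longrightarrow> 0 \<le> x \<and> x \<le> 1"
  using br_range unfolding step_def by force

lemma path_range: "step_path X \<Longrightarrow> 0 \<le> X j \<and> X j \<le> 1"
  unfolding step_path_def using step_range by blast

lemma path_hits: "reach x \<Longrightarrow> step_path X \<Longrightarrow> X j = x \<Longrightarrow> \<exists>k. 0 \<le> X k \<and> X k \<le> scale"
proof (induction arbitrary: j rule: reach.induct)
  case (step x)
  then have "step x (X (Suc j))" unfolding step_path_def by blast
  from step.IH[OF this step.prems(1) refl] show ?case .
qed auto

lemma follows_path_walk:
  "follows X j w \<Longrightarrow> k \<le> length w \<Longrightarrow> walk n1 n2 n3 n4 (take k w) (X j) (X (j + k))"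
proof (induction k)
  case (Suc k)
  then show ?case
    by (auto simp: take_Suc_conv_app_nth walk_append follows_def)
qed auto

lemma word_letters: "i < 4 \<Longrightarrow> j < 4 \<Longrightarrow> \<exists>k<length (word j). word j ! k = i"
proof -
  assume "i < 4" "j < 4"
  then have "i \<in> set (word j)"
    using less_4_cases[of i] less_4_cases[of j] by (auto simp: word_def)
  then show ?thesis by (auto simp: in_set_conv_nth)
qed

lemma scale_pos: "0 < scale"
  using t_pos by (simp add: scale_def)

text \<open>In rescaled coordinates a return is again a \<open>step\<close>, so the returns of a
  path form a path of the same relation.\<close>

lemma next_return:
  assumes "step_path X" "0 \<le> X j" "X j \<le> scale"
  shows "\<exists>k. 0 \<le> X k \<and> X k \<le> scale \<and>
    ((\<exists>i<4. follows X j (word i) \<and> br i (\<eta> * X j) (\<eta> * X k)) \<or> \<eta> * X j = 1 \<and> \<eta> * X k = 0)"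
proof -
  have "step (X (j + m)) (X (j + Suc m))" for m
    using assms(1) unfolding step_path_def by simp
  from first_return[of "\<lambda>m. X (j + m)", OF this] assms(2,3)
  consider i where "i < 4" "follows (\<lambda>m. X (j + m)) 0 (word i)"
      "branch t1 t2 t3 t4 i (X j) (X (j + length (word i)))"
    | k where "X j = scale" "X (j + k) = 0"
    by auto
  then show ?thesis
  proof cases
    case 1
    have br: "br i (\<eta> * X j) (\<eta> * X (j + length (word i)))"
      using 1(3) by (simp add: br_scaled)
    have "\<eta> * 0 \<le> \<eta> * X (j + length (word i))" "\<eta> * X (j + length (word i)) \<le> \<eta> * scale"
      using br_range[OF br] eta_scale by auto
    then have "0 \<le> X (j + length (word i))" "X (j + length (word i)) \<le> scale"
      using eta_gt by (simp_all add: zero_le_mult_iff)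
    moreover have "follows X j (word i)"
      using 1(2) unfolding follows_def by simp
    ultimately show ?thesis using 1(1) br by blast
  next
    case 2
    then show ?thesis using eta_scale scale_pos by (intro exI[of _ "j + k"]) auto
  qed
qed

lemma br_fun: "br i x y \<Longrightarrow> br j x y \<Longrightarrow> i = j"
  using pos unfolding branch_def by auto

lemma path_letters:
  assumes "step_path X" "i < 4"
  shows "\<exists>j. br i (X j) (X (Suc j))"
proof -
  have *: "\<exists>j. br i (X j) (X (Suc j))" if "follows X k (word i')" "i' < 4" for k i'
    using word_letters[OF \<open>i < 4\<close> that(2)] that(1) unfolding follows_def by blast
  obtain j where j: "0 \<le> X j" "X j \<le> scale"
    using path_hits[OF reach_all assms(1), of "X 0" 0] path_range[OF assms(1), of 0] by auto
  from next_return[OF assms(1) this] obtain k where k: "0 \<le> X k" "X k \<le> scale"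
    "(\<exists>i<4. follows X j (word i)) \<or> \<eta> * X j = 1 \<and> \<eta> * X k = 0"
    by blast
  show ?thesis
  proof (cases "\<exists>i<4. follows X j (word i)")
    case True
    then show ?thesis using * by blast
  next
    case False
    \<comment> \<open>A return by the extra step ends at 0, hence not at 1, so the return after it
      follows a full word.\<close>
    with k have "\<eta> * X k \<noteq> 1" by auto
    with next_return[OF assms(1) k(1,2)] show ?thesis using * by blast
  qed
qed

text \<open>The letter i is part of the conclusion because the induction needs it: the letter of the
  induced path tells which word the path follows, so the path visits the floor of y at the same
  height. Walking along a common word keeps the distance to y, and undoing the rescaling gains the
  factor 1/\<eta>.\<close>

proposition path_dense:
  assumes "step_path X" "y \<notin> endpoint_module" "br i y y'"
  shows "\<exists>j. br i (X j) (X (Suc j)) \<and> \<bar>X j - y\<bar> \<le> 1 / \<eta> ^ n"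
  using assms
proof (induction n arbitrary: X y y' i)
  case 0
  obtain j where "br i (X j) (X (Suc j))"
    using path_letters[OF 0(1)] branch_less_4[OF 0(3)] by blast
  moreover have "\<bar>X j - y\<bar> \<le> 1"
    using path_range[OF 0(1), of j] br_range[OF 0(3)] by auto
  ultimately show ?case by auto
next
  case (Suc n)
  have "on_floor y"
    using floor_cover[OF reach_all] br_range[OF Suc.prems(3)] Suc.prems(2) by blast
  then obtain i0 k x z where f: "i0 < 4" "k < length (word i0)" "x \<notin> endpoint_module" "branch t1 t2 t3 t4 i0 x z"
     "walk n1 n2 n3 n4 (take k (word i0)) x y"
    unfolding on_floor_def by blast
  \<comment> \<open>Splitting the word at height k identifies its letter there with the branch of y,
    which is unique because y is generic.\<close>
  have "walk n1 n2 n3 n4 (take k (word i0) @ word i0 ! k # drop (Suc k) (word i0)) x z"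
    using tower_walk[OF f(4)] id_take_nth_drop[OF f(2)] by simp
  then obtain v v' where v: "walk n1 n2 n3 n4 (take k (word i0)) x v" "br (word i0 ! k) v v'"
    by (auto simp: walk_append)
  have "v = y" using walk_dist[OF v(1) f(5)] by simp
  then have letter: "word i0 ! k = i" using br_unique Suc.prems v(2) by blast
  obtain j0 where j0: "0 \<le> X j0" "X j0 \<le> scale"
    using path_hits[OF reach_all Suc.prems(1), of "X 0" 0] path_range[OF Suc.prems(1), of 0] by auto
  \<comment> \<open>Return times by dependent choice; the positions at these times, multiplied by
    \<eta>, form the path for the induction hypothesis.\<close>
  have "\<exists>\<tau>. \<forall>m. (0 \<le> X (\<tau> m) \<and> X (\<tau> m) \<le> scale) \<and>
    ((\<exists>i<4. follows X (\<tau> m) (word i) \<and> br i (\<eta> * X (\<tau> m)) (\<eta> * X (\<tau> (Suc m)))) \<or>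
      \<eta> * X (\<tau> m) = 1 \<and> \<eta> * X (\<tau> (Suc m)) = 0)"
    by (rule dependent_nat_choice) (use j0 next_return[OF Suc.prems(1)] in blast)+
  then obtain \<tau> where \<tau>: "(\<exists>i<4. follows X (\<tau> m) (word i) \<and> br i (\<eta> * X (\<tau> m)) (\<eta> * X (\<tau> (Suc m)))) \<or>
      \<eta> * X (\<tau> m) = 1 \<and> \<eta> * X (\<tau> (Suc m)) = 0" for m
    by blast
  have "step_path (\<lambda>m. \<eta> * X (\<tau> m))"
    unfolding step_path_def step_def using \<tau> by blast
  from Suc.IH[OF this, of "\<eta> * x" i0 "\<eta> * z"] f(3,4) obtain m where
    m: "br i0 (\<eta> * X (\<tau> m)) (\<eta> * X (\<tau> (Suc m)))" "\<bar>\<eta> * X (\<tau> m) - \<eta> * x\<bar> \<le> 1 / \<eta> ^ n"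
    by (auto simp: endpoint_module_eta br_scaled)
  \<comment> \<open>The last branch sends 1 to n3 > 0, so the extra step is excluded and the path
    follows the word of the tower.\<close>
  have "\<not> (\<eta> * X (\<tau> m) = 1 \<and> \<eta> * X (\<tau> (Suc m)) = 0)"
    using m(1) pos sum1 by (auto simp: branch_def)
  with \<tau>[of m] have fol: "follows X (\<tau> m) (word i0)"
    using br_fun[OF m(1)] by blast
  have "br i (X (\<tau> m + k)) (X (Suc (\<tau> m + k)))"
    using fol f(2) letter unfolding follows_def by blast
  moreover have "\<bar>X (\<tau> m + k) - y\<bar> = \<bar>X (\<tau> m) - x\<bar>"
    using walk_dist[OF follows_path_walk[OF fol] f(5)] f(2) by simp
  moreover have "\<bar>\<eta> * X (\<tau> m) - \<eta> * x\<bar> = \<eta> * \<bar>X (\<tau> m) - x\<bar>"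
    using eta_gt by (simp add: abs_mult flip: right_diff_distrib)
  then have "\<bar>X (\<tau> m) - x\<bar> \<le> 1 / \<eta> ^ Suc n"
    using m(2) eta_gt by (simp add: field_simps)
  ultimately show ?case by (intro exI[of _ "\<tau> m + k"]) simp
qed

subsection \<open>Invariant distribution functions\<close>

text \<open>Closed branches are appropriate since distribution functions without atoms do not see
  endpoints. The total \<open>\<Phi> 1 - \<Phi> 0\<close> is left free because passing to
  \<open>\<Phi> (x / \<eta>)\<close> changes it.\<close>

definition flip_additive :: "(real \<Rightarrow> real) \<Rightarrow> bool" where
  "flip_additive \<Phi> \<longleftrightarrow> (\<forall>x y. 0 \<le> x \<longrightarrow> x \<le> y \<longrightarrow> y \<le> 1 \<longrightarrow> \<Phi> x \<le> \<Phi> y) \<and>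
     (\<forall>i x x' y y'. br i x x' \<longrightarrow> br i y y' \<longrightarrow> \<Phi> x' - \<Phi> y' = branch_sign i * (\<Phi> x - \<Phi> y))"

lemma additive_walk:
  assumes "flip_additive \<Phi>"
  shows "walk n1 n2 n3 n4 w x x' \<Longrightarrow> walk n1 n2 n3 n4 w y y' \<Longrightarrow>
    \<Phi> x' - \<Phi> y' = (\<Prod>k\<leftarrow>w. branch_sign k) * (\<Phi> x - \<Phi> y)"
proof (induction w arbitrary: x y)
  case (Cons i w)
  then obtain u v where uv: "br i x u" "walk n1 n2 n3 n4 w u x'" "br i y v" "walk n1 n2 n3 n4 w v y'"
    by auto
  have "\<Phi> u - \<Phi> v = branch_sign i * (\<Phi> x - \<Phi> y)"
    using assms uv(1,3) unfolding flip_additive_def by blast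
  then show ?case using Cons.IH[OF uv(2,4)] by simp
qed auto

lemma additive_renormalize:
  assumes "flip_additive \<Phi>"
  shows "flip_additive (\<lambda>x. \<Phi> (x / \<eta>))"
  unfolding flip_additive_def
proof (intro conjI allI impI)
  fix x y :: real
  assume "0 \<le> x" "x \<le> y" "y \<le> 1"
  then have "0 \<le> x / \<eta>" "x / \<eta> \<le> y / \<eta>" "y / \<eta> \<le> 1"
    using eta_gt by (auto simp: field_simps)
  then show "\<Phi> (x / \<eta>) \<le> \<Phi> (y / \<eta>)" using assms unfolding flip_additive_def by blast
next
  fix i x x' y y'
  assume *: "br i x x'" "br i y y'"
  then have "branch t1 t2 t3 t4 i (x / \<eta>) (x' / \<eta>)" "branch t1 t2 t3 t4 i (y / \<eta>) (y' / \<eta>)"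
    using br_scaled[of i "x / \<eta>" "x' / \<eta>"] br_scaled[of i "y / \<eta>" "y' / \<eta>"] eta_gt by simp_all
  from additive_walk[OF assms tower_walk[OF this(1)] tower_walk[OF this(2)]]
  show "\<Phi> (x' / \<eta>) - \<Phi> (y' / \<eta>) = branch_sign i * (\<Phi> (x / \<eta>) - \<Phi> (y / \<eta>))"
    using word_sign branch_less_4[OF *(1)] by simp
qed

definition mass :: "(real \<Rightarrow> real) \<Rightarrow> nat \<Rightarrow> real" where
  "mass \<Phi> i = [\<Phi> n1 - \<Phi> 0, \<Phi> (n1 + n2) - \<Phi> n1, \<Phi> (n1 + n2 + n3) - \<Phi> (n1 + n2),
     \<Phi> 1 - \<Phi> (n1 + n2 + n3)] ! i"

lemma mass_simps:
  "mass \<Phi> 0 = \<Phi> n1 - \<Phi> 0" "mass \<Phi> 1 = \<Phi> (n1 + n2) - \<Phi> n1"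
  "mass \<Phi> 2 = \<Phi> (n1 + n2 + n3) - \<Phi> (n1 + n2)" "mass \<Phi> 3 = \<Phi> 1 - \<Phi> (n1 + n2 + n3)"
  by (simp_all add: mass_def)

text \<open>Endpoints determine \<Phi> at the image cuts n3, n3 + n4 and n1 + n3 + n4, one after
  another in the image order 3, 4, 1; each branch is then compared with one endpoint. Masses may be
  0, which \<open>branch\<close> permits.\<close>

lemma additive_conjugates:
  assumes \<Phi>: "flip_additive \<Phi>" and xy: "br i x y"
  shows "branch (mass \<Phi> 0) (mass \<Phi> 1) (mass \<Phi> 2) (mass \<Phi> 3) i (\<Phi> x - \<Phi> 0) (\<Phi> y - \<Phi> 0)"
proof -
  have mono: "\<Phi> x \<le> \<Phi> y" if "0 \<le> x" "x \<le> y" "y \<le> 1" for x y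
    using \<Phi> that unfolding flip_additive_def by blast
  have diff: "\<Phi> x' - \<Phi> y' = branch_sign i * (\<Phi> x - \<Phi> y)" if "br i x x'" "br i y y'" for i x x' y y'
    using \<Phi> that unfolding flip_additive_def by blast
  have e: "br 0 0 (n1 + n3 + n4)" "br 0 n1 (n3 + n4)" "br 1 n1 (n1 + n3 + n4)"
    "br 2 (n1 + n2) 0" "br 2 (n1 + n2 + n3) n3" "br 3 (n1 + n2 + n3) (n3 + n4)" "br 3 1 n3"
    using pos sum1 by (auto simp: branch_def)
  have v3: "\<Phi> n3 - \<Phi> 0 = mass \<Phi> 2"
    using diff[OF e(5,4)] by (simp add: branch_sign_def mass_def)
  have v4: "\<Phi> (n3 + n4) - \<Phi> 0 = mass \<Phi> 2 + mass \<Phi> 3"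
    using diff[OF e(6,7)] v3 by (simp add: branch_sign_def mass_def)
  have v1: "\<Phi> (n1 + n3 + n4) - \<Phi> 0 = mass \<Phi> 0 + mass \<Phi> 2 + mass \<Phi> 3"
    using diff[OF e(1,2)] v4 by (simp add: branch_sign_def mass_def)
  have range: "0 \<le> x" "x \<le> 1" using br_range[OF xy] by auto
  consider "i = 0" | "i = 1" | "i = 2" | "i = 3" using xy by (auto simp: branch_def)
  then show ?thesis
  proof cases
    case 1
    have "x \<le> n1" using xy 1 by (simp add: branch_def)
    then have "0 \<le> \<Phi> x - \<Phi> 0" "\<Phi> x - \<Phi> 0 \<le> mass \<Phi> 0"
      using mono[of 0 x] mono[of x n1] range pos sum1 unfolding mass_simps by linarith+
    moreover have "\<Phi> y - \<Phi> 0 = mass \<Phi> 0 + mass \<Phi> 2 + mass \<Phi> 3 - (\<Phi> x - \<Phi> 0)"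
      using diff[of 0 x y 0, OF _ e(1)] xy v1 1 by (simp add: branch_sign_def)
    ultimately show ?thesis unfolding 1 by (rule branchI(1))
  next
    case 2
    have "n1 \<le> x" "x \<le> n1 + n2" using xy 2 by (simp_all add: branch_def)
    then have "mass \<Phi> 0 \<le> \<Phi> x - \<Phi> 0" "\<Phi> x - \<Phi> 0 \<le> mass \<Phi> 0 + mass \<Phi> 1"
      using mono[of n1 x] mono[of x "n1 + n2"] range pos sum1 unfolding mass_simps by linarith+
    moreover have "\<Phi> y - \<Phi> 0 = \<Phi> x - \<Phi> 0 + mass \<Phi> 2 + mass \<Phi> 3"
      using diff[of 1 x y n1, OF _ e(3)] xy v1 2 by (simp add: branch_sign_def mass_def)
    ultimately show ?thesis unfolding 2 by (rule branchI(2))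
  next
    case 3
    have "n1 + n2 \<le> x" "x \<le> n1 + n2 + n3" using xy 3 by (simp_all add: branch_def)
    then have "mass \<Phi> 0 + mass \<Phi> 1 \<le> \<Phi> x - \<Phi> 0" "\<Phi> x - \<Phi> 0 \<le> mass \<Phi> 0 + mass \<Phi> 1 + mass \<Phi> 2"
      using mono[of "n1 + n2" x] mono[of x "n1 + n2 + n3"] range pos sum1 unfolding mass_simps by linarith+
    moreover have "\<Phi> y - \<Phi> 0 = \<Phi> x - \<Phi> 0 - mass \<Phi> 0 - mass \<Phi> 1"
      using diff[of 2 x y "n1 + n2", OF _ e(4)] xy 3 by (simp add: branch_sign_def mass_def)
    ultimately show ?thesis unfolding 3 by (rule branchI(3))
  next
    case 4
    have "n1 + n2 + n3 \<le> x" using xy 4 by (simp add: branch_def)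
    then have "mass \<Phi> 0 + mass \<Phi> 1 + mass \<Phi> 2 \<le> \<Phi> x - \<Phi> 0"
      "\<Phi> x - \<Phi> 0 \<le> mass \<Phi> 0 + mass \<Phi> 1 + mass \<Phi> 2 + mass \<Phi> 3"
      using mono[of "n1 + n2 + n3" x] mono[of x 1] range pos sum1 unfolding mass_simps by linarith+
    moreover have "\<Phi> y - \<Phi> 0 = mass \<Phi> 0 + mass \<Phi> 1 + 2 * mass \<Phi> 2 + mass \<Phi> 3 - (\<Phi> x - \<Phi> 0)"
      using diff[of 3 x y 1, OF _ e(7)] xy v3 4 by (simp add: branch_sign_def mass_def)
    ultimately show ?thesis unfolding 4 by (rule branchI(4))
  qed
qed

lemma mass_renormalize:
  assumes "flip_additive \<Phi>" and \<Phi>': "\<Phi>' = (\<lambda>x. \<Phi> (x / \<eta>))"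
  shows "mass \<Phi> 0 = 3 * mass \<Phi>' 0 + 3 * mass \<Phi>' 1 + 5 * mass \<Phi>' 2 + 4 * mass \<Phi>' 3"
    "mass \<Phi> 1 = mass \<Phi>' 0 + 2 * mass \<Phi>' 1 + 3 * mass \<Phi>' 2 + 3 * mass \<Phi>' 3"
    "mass \<Phi> 2 = mass \<Phi>' 0 + mass \<Phi>' 1 + 2 * mass \<Phi>' 2 + mass \<Phi>' 3"
    "mass \<Phi> 3 = 2 * mass \<Phi>' 0 + 3 * mass \<Phi>' 1 + 5 * mass \<Phi>' 2 + 5 * mass \<Phi>' 3"
proof -
  define w where "w = walk (mass \<Phi> 0) (mass \<Phi> 1) (mass \<Phi> 2) (mass \<Phi> 3)"
  have walks: "w v (\<Phi> x - \<Phi> 0) (\<Phi> y - \<Phi> 0)" if "walk n1 n2 n3 n4 v x y" for v x y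
    using that
  proof (induction v arbitrary: x)
    case (Cons i v)
    then obtain z where "br i x z" "walk n1 n2 n3 n4 v z y" by auto
    with Cons.IH[of z] additive_conjugates[OF assms(1)] show ?case by (auto simp: w_def)
  qed (simp add: w_def)
  have both: "\<exists>p q. w (word i) p q \<and> branch (mass \<Phi>' 0) (mass \<Phi>' 1) (mass \<Phi>' 2) (mass \<Phi>' 3) i p q"
    if "br i x y" for i x y
  proof -
    have "branch t1 t2 t3 t4 i (x / \<eta>) (y / \<eta>)"
      using that br_scaled[of i "x / \<eta>" "y / \<eta>"] eta_gt by simp
    from walks[OF tower_walk[OF this]]
    have "w (word i) (\<Phi>' x - \<Phi>' 0) (\<Phi>' y - \<Phi>' 0)" by (simp add: \<Phi>')
    with additive_conjugates[OF additive_renormalize[OF assms(1)] that] show ?thesis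
      unfolding \<Phi>' by blast
  qed
  \<comment> \<open>One sample point for each letter; its position cancels below.\<close>
  have "br 0 0 (n1 + n3 + n4)" "br 1 n1 (n1 + n3 + n4)" "br 2 (n1 + n2) 0" "br 3 1 n3"
    using pos sum1 by (auto simp: branch_def)
  note b = this[THEN both, unfolded w_def]
  \<comment> \<open>A return word and the small branch have the same sign, so positions cancel and
    each letter leaves one linear relation between the two mass vectors. Solving the four relations
    for the masses of \<Phi> produces P.\<close>
  have c0: "- 3 * mass \<Phi> 1 + 2 * mass \<Phi> 3 = mass \<Phi>' 0 + mass \<Phi>' 2 + mass \<Phi>' 3"
    using b(1) by (auto dest!: walk_word_value(1) simp: branch_def)
  have c1: "- mass \<Phi> 0 - 2 * mass \<Phi> 1 + mass \<Phi> 2 + 2 * mass \<Phi> 3 = mass \<Phi>' 2 + mass \<Phi>' 3"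
    using b(2) by (auto dest!: walk_word_value(2)[unfolded One_nat_def] simp: branch_def)
  have c2: "- 2 * mass \<Phi> 0 - 3 * mass \<Phi> 1 + 2 * mass \<Phi> 2 + 3 * mass \<Phi> 3 = - mass \<Phi>' 0 - mass \<Phi>' 1"
    using b(3) by (auto dest!: walk_word_value(3) simp: branch_def)
  have c3: "mass \<Phi> 2 = mass \<Phi>' 0 + mass \<Phi>' 1 + 2 * mass \<Phi>' 2 + mass \<Phi>' 3"
    using b(4) by (auto dest!: walk_word_value(4) simp: branch_def)
  show "mass \<Phi> 0 = 3 * mass \<Phi>' 0 + 3 * mass \<Phi>' 1 + 5 * mass \<Phi>' 2 + 4 * mass \<Phi>' 3"
    "mass \<Phi> 1 = mass \<Phi>' 0 + 2 * mass \<Phi>' 1 + 3 * mass \<Phi>' 2 + 3 * mass \<Phi>' 3"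
    "mass \<Phi> 2 = mass \<Phi>' 0 + mass \<Phi>' 1 + 2 * mass \<Phi>' 2 + mass \<Phi>' 3"
    "mass \<Phi> 3 = 2 * mass \<Phi>' 0 + 3 * mass \<Phi>' 1 + 5 * mass \<Phi>' 2 + 5 * mass \<Phi>' 3"
    using c0 c1 c2 c3 by linarith+
qed

definition P_entry :: "nat \<Rightarrow> nat \<Rightarrow> real" where
  "P_entry i j = [[3, 3, 5, 4], [1, 2, 3, 3], [1, 1, 2, 1], [2, 3, 5, 5]] ! i ! j"

lemma mass_proportional:
  assumes "flip_additive \<Phi>"
  shows "mass \<Phi> 0 = (\<Phi> 1 - \<Phi> 0) * n1" "mass \<Phi> 1 = (\<Phi> 1 - \<Phi> 0) * n2"
    "mass \<Phi> 2 = (\<Phi> 1 - \<Phi> 0) * n3" "mass \<Phi> 3 = (\<Phi> 1 - \<Phi> 0) * n4"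
proof -
  define \<Psi> where "\<Psi> = (\<lambda>k x. \<Phi> (x / \<eta> ^ k))"
  define v where "v = (\<lambda>i::nat. [n1, n2, n3, n4] ! i)"
  have \<Psi>_Suc: "\<Psi> (Suc k) = (\<lambda>x. \<Psi> k (x / \<eta>))" for k
    unfolding \<Psi>_def by (simp add: mult.commute)
  have add: "flip_additive (\<Psi> k)" for k
  proof (induction k)
    case (Suc k)
    then show ?case unfolding \<Psi>_Suc by (rule additive_renormalize)
  qed (use assms in \<open>simp add: \<Psi>_def\<close>)
  have range4: "i \<in> {..<4} \<Longrightarrow> i = 0 \<or> i = 1 \<or> i = 2 \<or> i = 3" for i :: nat
    using less_4_cases by simp
  obtain c where c: "\<And>i. i \<in> {..<4} \<Longrightarrow> mass (\<Psi> 0) i = c * v i"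
  proof (rule positive_backward_orbit[of "{..<4}" P_entry v \<eta> "\<lambda>k. mass (\<Psi> k)"])
    fix i j :: nat assume i: "i \<in> {..<4}" and j: "j \<in> {..<4}"
    show "0 < P_entry i j"
      using range4[OF i] range4[OF j] by (auto simp: P_entry_def)
  next
    fix i :: nat assume i: "i \<in> {..<4}"
    show "0 < v i" using range4[OF i] pos by (auto simp: v_def)
    show "(\<Sum>j<4. P_entry i j * v j) = \<eta> * v i"
      using range4[OF i] eig unfolding sum_less_4 by (auto simp: v_def P_entry_def)
    show "0 \<le> mass (\<Psi> k) i" for k
    proof -
      have mono: "\<Psi> k x \<le> \<Psi> k y" if "0 \<le> x" "x \<le> y" "y \<le> 1" for x y
        using add[of k] that unfolding flip_additive_def by blast
      show ?thesis
        using range4[OF i] mono[of 0 n1] mono[of n1 "n1 + n2"] mono[of "n1 + n2" "n1 + n2 + n3"]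
          mono[of "n1 + n2 + n3" 1] pos sum1 by (auto simp: mass_def)
    qed
    show "mass (\<Psi> k) i = (\<Sum>j<4. P_entry i j * mass (\<Psi> (Suc k)) j)" for k
      using range4[OF i] mass_renormalize[OF add[of k] \<Psi>_Suc] unfolding sum_less_4
      by (auto simp: P_entry_def)
  qed (use eta_gt in \<open>auto\<close>)
  have m: "mass \<Phi> 0 = c * n1" "mass \<Phi> 1 = c * n2" "mass \<Phi> 2 = c * n3" "mass \<Phi> 3 = c * n4"
    using c[of 0] c[of 1] c[of 2] c[of 3] by (simp_all add: v_def \<Psi>_def)
  \<comment> \<open>The factor is found from the total: the masses telescope and the lengths add up
    to 1.\<close>
  have "\<Phi> 1 - \<Phi> 0 = c * (n1 + n2 + n3 + n4)"
    using m unfolding distrib_left by (simp add: mass_def)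
  then have "c = \<Phi> 1 - \<Phi> 0" using sum1 by simp
  with m show "mass \<Phi> 0 = (\<Phi> 1 - \<Phi> 0) * n1" "mass \<Phi> 1 = (\<Phi> 1 - \<Phi> 0) * n2"
    "mass \<Phi> 2 = (\<Phi> 1 - \<Phi> 0) * n3" "mass \<Phi> 3 = (\<Phi> 1 - \<Phi> 0) * n4"
    by simp_all
qed

text \<open>Since masses are proportional to lengths, a branch changes the deviation from linearity
  at most in sign. Induction over \<open>reach\<close> therefore carries the estimate from the base,
  where it is the previous level, to all of [0, 1].\<close>

lemma additive_almost_linear:
  assumes "flip_additive \<Phi>" "0 \<le> x" "x \<le> 1"
  shows "\<bar>\<Phi> x - \<Phi> 0 - (\<Phi> 1 - \<Phi> 0) * x\<bar> \<le> (\<Phi> 1 - \<Phi> 0) / \<eta> ^ k"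
  using assms
proof (induction k arbitrary: \<Phi> x)
  case 0
  have "\<Phi> 0 \<le> \<Phi> x" "\<Phi> x \<le> \<Phi> 1" "\<Phi> 0 \<le> \<Phi> 1"
    using 0 unfolding flip_additive_def by auto
  moreover from this have "0 \<le> (\<Phi> 1 - \<Phi> 0) * x" "(\<Phi> 1 - \<Phi> 0) * x \<le> (\<Phi> 1 - \<Phi> 0) * 1"
    using 0 by (intro mult_nonneg_nonneg mult_left_mono; simp)+
  ultimately show ?case unfolding power_0 div_by_1 mult_1_right by linarith
next
  case (Suc k)
  define c where "c = \<Phi> 1 - \<Phi> 0"
  define \<Phi>' where "\<Phi>' = (\<lambda>x. \<Phi> (x / \<eta>))"
  have add': "flip_additive \<Phi>'" using additive_renormalize Suc.prems(1) unfolding \<Phi>'_def .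
  define c' where "c' = \<Phi>' 1 - \<Phi>' 0"
  have m: "mass \<Phi> 0 = c * n1" "mass \<Phi> 1 = c * n2" "mass \<Phi> 2 = c * n3" "mass \<Phi> 3 = c * n4"
    using mass_proportional[OF Suc.prems(1)] unfolding c_def .
  have m': "mass \<Phi>' 0 = c' * n1" "mass \<Phi>' 1 = c' * n2" "mass \<Phi>' 2 = c' * n3" "mass \<Phi>' 3 = c' * n4"
    using mass_proportional[OF add'] unfolding c'_def .
  have "c * n1 = c' * (3 * n1 + 3 * n2 + 5 * n3 + 4 * n4)"
    using mass_renormalize(1)[OF Suc.prems(1) \<Phi>'_def] unfolding m m'
    by (simp add: algebra_simps)
  \<comment> \<open>The first component of the eigenvalue equation; this is the source of the gained
    factor 1/\<eta>.\<close>
  then have c: "c = c' * \<eta>"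
    unfolding eig(1)[symmetric] using pos(1) by simp
  have "reach x" using reach_all Suc.prems by blast
  then have "0 \<le> x \<Longrightarrow> x \<le> 1 \<Longrightarrow> \<bar>\<Phi> x - \<Phi> 0 - c * x\<bar> \<le> c / \<eta> ^ Suc k"
  proof (induction rule: reach.induct)
    case (base x)
    have "0 \<le> \<eta> * x" "\<eta> * x \<le> 1"
      using base eta_gt eta_scale mult_left_mono[of x scale \<eta>] by auto
    from Suc.IH[OF add' this]
    have "\<bar>\<Phi>' (\<eta> * x) - \<Phi>' 0 - c' * (\<eta> * x)\<bar> \<le> c' / \<eta> ^ k"
      unfolding c'_def .
    moreover have "\<Phi>' (\<eta> * x) = \<Phi> x" "\<Phi>' 0 = \<Phi> 0" "c' * (\<eta> * x) = c * x" "c' / \<eta> ^ k = c / \<eta> ^ Suc k"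
      using eta_gt by (simp_all add: \<Phi>'_def c)
    ultimately show ?case by simp
  next
    case (step x)
    obtain i y where xy: "br i x y" using br_dom step.prems by blast
    have "\<bar>\<Phi> y - \<Phi> 0 - c * y\<bar> \<le> c / \<eta> ^ Suc k"
      using step.IH[of y] xy br_range[OF xy] unfolding step_def by blast
    moreover have "\<Phi> y - \<Phi> 0 - c * y = branch_sign i * (\<Phi> x - \<Phi> 0 - c * x)"
      using additive_conjugates[OF Suc.prems(1) xy] xy unfolding m
      by (auto simp: branch_def branch_sign_def right_diff_distrib distrib_left)
    then have "\<bar>\<Phi> y - \<Phi> 0 - c * y\<bar> = \<bar>\<Phi> x - \<Phi> 0 - c * x\<bar>"
      by (simp add: branch_sign_def abs_minus_commute split: if_splits)
    ultimately show ?case by simp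
  qed
  then show ?case using Suc.prems unfolding c_def by blast
qed

proposition additive_linear:
  assumes "flip_additive \<Phi>" "0 \<le> x" "x \<le> 1"
  shows "\<Phi> x = \<Phi> 0 + (\<Phi> 1 - \<Phi> 0) * x"
proof -
  have "(\<lambda>k. (\<Phi> 1 - \<Phi> 0) / \<eta> ^ k) \<longlonglongrightarrow> 0"
    using eta_gt by (intro LIMSEQ_divide_realpow_zero) simp
  then have "\<bar>\<Phi> x - \<Phi> 0 - (\<Phi> 1 - \<Phi> 0) * x\<bar> \<le> 0"
    using additive_almost_linear[OF assms] by (intro LIMSEQ_le_const) auto
  then show ?thesis by simp
qed

end

section \<open>Probability measures on an interval\<close>

lemma interval_prob_eqI:
  fixes M N :: "real measure"
  assumes "prob_space M" "prob_space N"
    and setsM: "sets M = sets (restrict_space borel {0..L})"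
    and setsN: "sets N = sets (restrict_space borel {0..L})"
    and "0 \<le> L"
    and eq: "\<And>x. 0 \<le> x \<Longrightarrow> x \<le> L \<Longrightarrow> measure M {0..x} = measure N {0..x}"
  shows "M = N"
proof -
  interpret M: prob_space M by fact
  interpret N: prob_space N by fact
  have space: "space M = {0..L}" "space N = {0..L}"
    using sets_eq_imp_space_eq[OF setsM] sets_eq_imp_space_eq[OF setsN]
    by (simp_all add: space_restrict_space)
  have idM: "(\<lambda>x. x) \<in> M \<rightarrow>\<^sub>M borel" and idN: "(\<lambda>x. x) \<in> N \<rightarrow>\<^sub>M borel"
    unfolding measurable_cong_sets[OF setsM refl] measurable_cong_sets[OF setsN refl]
    by (auto intro: measurable_restrict_space1)
  \<comment> \<open>The measures live on a subspace of the line; the inclusion moves them to the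
    whole line, where a cdf determines a distribution.\<close>
  define M' where "M' = distr M borel (\<lambda>x. x)"
  define N' where "N' = distr N borel (\<lambda>x. x)"
  have "real_distribution M'" "real_distribution N'"
    unfolding M'_def N'_def using M.real_distribution_distr[OF idM] N.real_distribution_distr[OF idN] by auto
  moreover have "cdf M' x = cdf N' x" for x
  proof -
    have "cdf M' x = measure M ({..x} \<inter> {0..L})" "cdf N' x = measure N ({..x} \<inter> {0..L})"
      unfolding cdf_def M'_def N'_def by (simp_all add: measure_distr idM idN space vimage_def Int_def)
    moreover have "{..x} \<inter> {0..L} = (if x < 0 then {} else {0..min x L})" by auto
    ultimately show ?thesis using eq[of "min x L"] \<open>0 \<le> L\<close> by (cases "x < 0") simp_all
  qed
  ultimately have "M' = N'" by (intro cdf_unique) auto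
  show ?thesis
  proof (rule measure_eqI)
    show "sets M = sets N" using setsM setsN by simp
    fix A assume A: "A \<in> sets M"
    then have borel: "A \<in> sets borel" and sub: "A \<subseteq> {0..L}"
      unfolding setsM by (auto simp: sets_restrict_space)
    have "emeasure M A = emeasure M' A"
      unfolding M'_def using borel sub by (simp add: emeasure_distr idM space Int_absorb2)
    also have "\<dots> = emeasure N A"
      unfolding \<open>M' = N'\<close> N'_def using borel sub by (simp add: emeasure_distr idN space Int_absorb2)
    finally show "emeasure M A = emeasure N A" .
  qed
qed

lemma sets_normalized_lebesgue: "sets (normalized_lebesgue L) = sets (restrict_space borel {0..L})"
  unfolding normalized_lebesgue_def sets_uniform_measure
  by (intro sets_restrict_space_cong) simp

lemma emeasure_normalized_lebesgue:
  assumes "0 < L" "A \<in> sets borel" "A \<subseteq> {0..L}"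
  shows "emeasure (normalized_lebesgue L) A = emeasure lborel A / ennreal L"
proof -
  have A: "A \<in> sets (restrict_space lborel {0..L})"
    using assms(2,3) by (auto simp: sets_restrict_space)
  have X: "{0..L} \<in> sets (restrict_space lborel {0..L})"
    by (auto simp: sets_restrict_space)
  show ?thesis
    unfolding normalized_lebesgue_def
    using assms A X by (simp add: emeasure_uniform_measure emeasure_restrict_space Int_absorb1)
qed

lemma measure_normalized_lebesgue:
  assumes "0 < L" "0 \<le> x" "x \<le> L"
  shows "measure (normalized_lebesgue L) {0..x} = x / L"
proof -
  have "emeasure (normalized_lebesgue L) {0..x} = ennreal (x / L)"
    using assms by (simp add: emeasure_normalized_lebesgue divide_ennreal)
  then show ?thesis using assms by (simp add: measure_def)
qed

lemma prob_space_normalized_lebesgue: "0 < L \<Longrightarrow> prob_space (normalized_lebesgue L)"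
proof
  assume "0 < L"
  moreover have "space (normalized_lebesgue L) = {0..L}"
    using sets_eq_imp_space_eq[OF sets_normalized_lebesgue] by (simp add: space_restrict_space)
  ultimately show "emeasure (normalized_lebesgue L) (space (normalized_lebesgue L)) = 1"
    by (simp add: emeasure_normalized_lebesgue ennreal_divide_self)
qed

locale interval_prob = prob_space M for M :: "real measure" +
  fixes L :: real
  assumes sets_M: "sets M = sets (restrict_space borel {0..L})"
    and no_atoms: "\<And>x. 0 \<le> x \<Longrightarrow> x \<le> L \<Longrightarrow> measure M {x} = 0"
begin

lemma space_M: "space M = {0..L}"
  using sets_eq_imp_space_eq[OF sets_M] by (simp add: space_restrict_space)

lemma setsI: "A \<in> sets borel \<Longrightarrow> A \<subseteq> {0..L} \<Longrightarrow> A \<in> sets M"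
  unfolding sets_M by (auto simp: sets_restrict_space)

lemma measure_interval:
  assumes "0 \<le> u" "u \<le> v" "v \<le> L"
  shows "measure M {u<..<v} = measure M {0..v} - measure M {0..u}"
proof (cases "u = v")
  case False
  have "measure M ({0..u} \<union> {u<..v}) = measure M {0..u} + measure M {u<..v}"
    using assms by (intro finite_measure_Union setsI) auto
  moreover have "measure M ({u<..<v} \<union> {v}) = measure M {u<..<v} + measure M {v}"
    using assms False by (intro finite_measure_Union setsI) auto
  moreover have "{0..u} \<union> {u<..v} = {0..v}" "{u<..<v} \<union> {v} = {u<..v}"
    using assms False by auto
  ultimately show ?thesis using no_atoms[of v] assms by simp
qed simp

end

section \<open>The flipped interval exchange\<close>

text \<open>T in the lengths n: the intervals of T have lengths n1, n2 + n3, n3 + n4, n2, so the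
  third interval ends at n1 + n2 + 2 * n3 + n4 = 1 + n3 and the fourth at 1 + n2 + n3.\<close>

locale flipped_exchange = perron_direction +
  fixes L :: real and T :: "real \<Rightarrow> real"
  assumes L: "L = 1 + n2 + n3"
    and T1: "0 \<le> x \<Longrightarrow> x < n1 \<Longrightarrow> T x = n1 + n3 + n4 - x"
    and T2: "n1 \<le> x \<Longrightarrow> x < n1 + n2 + n3 \<Longrightarrow> T x = n1 + L - x"
    and T3: "n1 + n2 + n3 \<le> x \<Longrightarrow> x < 1 + n3 \<Longrightarrow> T x = 1 + n3 - x"
    and T4: "1 + n3 \<le> x \<Longrightarrow> x \<le> L \<Longrightarrow> T x = n1 + n3 + n4 + L - x"
begin

lemma T_cases:
  assumes "0 \<le> x" "x \<le> L"
  obtains "0 \<le> x" "x < n1" "T x = n1 + n3 + n4 - x"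
    | "n1 \<le> x" "x < n1 + n2 + n3" "T x = n1 + L - x"
    | "n1 + n2 + n3 \<le> x" "x < 1 + n3" "T x = 1 + n3 - x"
    | "1 + n3 \<le> x" "x \<le> L" "T x = n1 + n3 + n4 + L - x"
  using assms T1[of x] T2[of x] T3[of x] T4[of x] by linarith

lemma T_range:
  assumes "0 \<le> x" "x \<le> L"
  shows "0 \<le> T x \<and> T x \<le> L"
  using T_cases[OF assms] by cases (use assms L pos sum1 in linarith)+

lemma orbit_range: "0 \<le> x \<Longrightarrow> x \<le> L \<Longrightarrow> 0 \<le> (T ^^ k) x \<and> (T ^^ k) x \<le> L"
  by (induction k) (auto dest: T_range)

lemma T_enters:
  assumes "0 \<le> x" "x \<le> L"
  shows "\<exists>k. 0 \<le> (T ^^ k) x \<and> (T ^^ k) x \<le> 1"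
proof (cases "x \<le> 1")
  case True
  then show ?thesis using assms by (intro exI[of _ 0]) simp
next
  case False
  have "0 \<le> T x \<and> T x \<le> 1"
    using T_cases[OF assms] by cases (use False assms L pos sum1 in linarith)+
  then show ?thesis by (intro exI[of _ 1]) simp
qed

text \<open>Letters 1 and 2 leave [0, 1] for one step. The extra clause records the intermediate
  point, by which targets above 1 are approached.\<close>

lemma T_induces:
  assumes "0 \<le> x" "x \<le> 1"
  shows "\<exists>i k. br i x ((T ^^ k) x) \<and> (i = 1 \<or> i = 2 \<longrightarrow> T x = n1 + L - x)"
proof -
  have x: "0 \<le> x" "x \<le> L" using assms L pos by auto
  \<comment> \<open>The point n1 + n2 goes with letter 1: its image 1 + n3 belongs to the fourth
    interval of T.\<close>
  consider "x < n1" | "n1 \<le> x" "x \<le> n1 + n2" | "n1 + n2 < x" "x < n1 + n2 + n3" | "n1 + n2 + n3 \<le> x"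
    by linarith
  then show ?thesis
  proof cases
    case 1
    then have "br 0 x (T x)" using T1 assms pos by (auto simp: branch_def)
    then show ?thesis by (intro exI[of _ 0] exI[of _ 1]) auto
  next
    case 2
    have a: "T x = n1 + L - x" by (rule T2; use 2 pos in linarith)
    have "T (T x) = n1 + n3 + n4 + L - T x" by (rule T4; use a 2 L pos in linarith)
    with a 2 have "br 1 x (T (T x))" by (simp add: branch_def)
    with a show ?thesis by (intro exI[of _ 1] exI[of _ 2]) (auto simp: eval_nat_numeral)
  next
    case 3
    have a: "T x = n1 + L - x" by (rule T2; use 3 pos in linarith)
    have "T (T x) = 1 + n3 - T x" by (rule T3; use a 3 L pos sum1 in linarith)
    with a 3 L have "br 2 x (T (T x))" by (simp add: branch_def)
    with a show ?thesis by (intro exI[of _ 2] exI[of _ 2]) (auto simp: eval_nat_numeral)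
  next
    case 4
    have "T x = 1 + n3 - x" by (rule T3; use 4 assms pos in linarith)
    then have "br 3 x (T x)" using 4 assms sum1 by (simp add: branch_def)
    then show ?thesis by (intro exI[of _ 3] exI[of _ 1]) auto
  qed
qed

lemma induced_path:
  assumes "0 \<le> x" "x \<le> L"
  obtains \<tau> where "step_path (\<lambda>m. (T ^^ \<tau> m) x)"
    and "\<And>m i. br i ((T ^^ \<tau> m) x) ((T ^^ \<tau> (Suc m)) x) \<Longrightarrow> i = 1 \<or> i = 2 \<Longrightarrow>
           (T ^^ Suc (\<tau> m)) x = n1 + L - (T ^^ \<tau> m) x"
proof -
  let ?X = "\<lambda>k. (T ^^ k) x"
  obtain j0 where j0: "0 \<le> ?X j0" "?X j0 \<le> 1" using T_enters[OF assms] by blast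
  have next_visit: "\<exists>k. (0 \<le> ?X k \<and> ?X k \<le> 1) \<and>
      (\<exists>i. br i (?X j) (?X k) \<and> (i = 1 \<or> i = 2 \<longrightarrow> ?X (Suc j) = n1 + L - ?X j))"
    if j: "0 \<le> ?X j \<and> ?X j \<le> 1" for j
  proof -
    obtain i k where ik: "br i (?X j) ((T ^^ k) (?X j))" "i = 1 \<or> i = 2 \<longrightarrow> T (?X j) = n1 + L - ?X j"
      using T_induces j by blast
    have "(T ^^ k) (?X j) = ?X (k + j)" by (simp add: funpow_add)
    with ik br_range[OF ik(1)] show ?thesis by (intro exI[of _ "k + j"]) auto
  qed
  have "\<exists>\<tau>. \<forall>m. (0 \<le> ?X (\<tau> m) \<and> ?X (\<tau> m) \<le> 1) \<and>
      (\<exists>i. br i (?X (\<tau> m)) (?X (\<tau> (Suc m))) \<and>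
        (i = 1 \<or> i = 2 \<longrightarrow> ?X (Suc (\<tau> m)) = n1 + L - ?X (\<tau> m)))"
    by (rule dependent_nat_choice) (use j0 next_visit in blast)+
  then obtain \<tau> where \<tau>: "\<exists>i. br i (?X (\<tau> m)) (?X (\<tau> (Suc m))) \<and>
        (i = 1 \<or> i = 2 \<longrightarrow> ?X (Suc (\<tau> m)) = n1 + L - ?X (\<tau> m))" for m
    by blast
  show thesis
  proof (rule that[of \<tau>])
    show "step_path (\<lambda>m. ?X (\<tau> m))" unfolding step_path_def step_def using \<tau> by blast
    show "?X (Suc (\<tau> m)) = n1 + L - ?X (\<tau> m)"
      if "br i (?X (\<tau> m)) (?X (\<tau> (Suc m)))" "i = 1 \<or> i = 2" for m i
      using \<tau>[of m] br_fun[OF that(1)] that(2) by blast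
  qed
qed

lemma orbit_approaches:
  assumes x: "0 \<le> x" "x \<le> L" and y: "0 \<le> y" "y \<le> L" "y \<noteq> 1" "y \<notin> endpoint_module"
  shows "\<exists>k. \<bar>(T ^^ k) x - y\<bar> \<le> 1 / \<eta> ^ n"
proof -
  obtain \<tau> where step_path: "step_path (\<lambda>m. (T ^^ \<tau> m) x)"
    and flip: "\<And>m i. br i ((T ^^ \<tau> m) x) ((T ^^ \<tau> (Suc m)) x) \<Longrightarrow> i = 1 \<or> i = 2 \<Longrightarrow>
           (T ^^ Suc (\<tau> m)) x = n1 + L - (T ^^ \<tau> m) x"
    using induced_path[OF x] by blast
  show ?thesis
  proof (cases "y \<le> 1")
    case True
    then obtain i z where "br i y z" using br_dom y by blast
    then show ?thesis using path_dense[OF step_path y(4)] by blast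
  next
    case False
    \<comment> \<open>\<open>y0\<close> is the preimage of y in the second interval of T. If the
      orbit is close to \<open>y0\<close> and leaves by letter 1 or 2, its next point is equally
      close to y.\<close>
    define y0 where "y0 = n1 + L - y"
    have y0: "0 \<le> y0" "y0 \<le> 1" "n1 < y0 \<or> y0 = n1" "y0 < n1 + n2 + n3"
      using False y L pos sum1 by (auto simp: y0_def)
    have "n1 + L \<in> endpoint_module" unfolding L by (intro endpoint_module_add endpoint_module_basis endpoint_module_1)
    then have "y0 \<notin> endpoint_module" unfolding y0_def using endpoint_module_diff_iff y(4) by blast
    then have ne: "y0 \<noteq> n1" "y0 \<noteq> n1 + n2" using endpoint_module_basis endpoint_module_add by blast+
    obtain i z where i: "br i y0 z" using br_dom y0 by blast
    then have i12: "i = 1 \<or> i = 2"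
      using br_index(2,3)[OF i] y0 ne by linarith
    obtain m where m: "br i ((T ^^ \<tau> m) x) ((T ^^ \<tau> (Suc m)) x)"
        "\<bar>(T ^^ \<tau> m) x - y0\<bar> \<le> 1 / \<eta> ^ n"
      using path_dense[OF step_path \<open>y0 \<notin> endpoint_module\<close> i] by blast
    have "\<bar>(T ^^ Suc (\<tau> m)) x - y\<bar> \<le> 1 / \<eta> ^ n"
      using flip[OF m(1) i12] m(2) unfolding y0_def by linarith
    then show ?thesis by blast
  qed
qed

lemma L_pos: "0 < L" "1 < L"
  using L pos by auto

theorem minimal: "minimal_on_interval L T"
  unfolding minimal_on_interval_def
proof
  fix x assume "x \<in> {0..L}"
  then have x: "0 \<le> x" "x \<le> L" by auto
  have orbit: "forward_orbit T x \<subseteq> {0..L}"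
    using orbit_range[OF x] by (auto simp: forward_orbit_def)
  show "closure (forward_orbit T x) = {0..L}"
  proof
    show "closure (forward_orbit T x) \<subseteq> {0..L}"
      using orbit by (intro closure_minimal) auto
    show "{0..L} \<subseteq> closure (forward_orbit T x)"
    proof
      fix y assume "y \<in> {0..L}"
      then have y: "0 \<le> y" "y \<le> L" by auto
      show "y \<in> closure (forward_orbit T x)"
        unfolding closure_approachable
      proof (intro allI impI)
        fix \<epsilon> :: real assume "0 < \<epsilon>"
        obtain n where n: "(1 / \<eta>) ^ n < \<epsilon> / 2"
          using real_arch_pow_inv[of "\<epsilon> / 2" "1 / \<eta>"] \<open>0 < \<epsilon>\<close> eta_gt by auto
        \<comment> \<open>Only generic targets are approached directly; they are dense, and one is
          taken on a side of y that stays inside the interval.\<close>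
        obtain y' where y': "y' \<notin> endpoint_module" "0 \<le> y'" "y' \<le> L" "y' \<noteq> 1" "\<bar>y - y'\<bar> < \<epsilon> / 2"
        proof (cases "y < 1")
          case True
          then obtain y' where "y' \<notin> endpoint_module" "y < y'" "y' < min 1 (y + \<epsilon> / 2)"
            using endpoint_module_codense[of y "min 1 (y + \<epsilon> / 2)"] \<open>0 < \<epsilon>\<close> by auto
          then show ?thesis using that[of y'] y L_pos by auto
        next
          case False
          then obtain y' where "y' \<notin> endpoint_module" "max 0 (y - \<epsilon> / 2) < y'" "y' < y"
            using endpoint_module_codense[of "max 0 (y - \<epsilon> / 2)" y] \<open>0 < \<epsilon>\<close> by auto
          then show ?thesis using that[of y'] y endpoint_module_1 by auto
        qed
        obtain k where "\<bar>(T ^^ k) x - y'\<bar> \<le> 1 / \<eta> ^ n"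
          using orbit_approaches[OF x y'(2,3,4,1)] by blast
        then have "dist ((T ^^ k) x) y < \<epsilon>"
          using n y'(5) unfolding dist_real_def power_one_over by linarith
        then show "\<exists>z\<in>forward_orbit T x. dist z y < \<epsilon>"
          unfolding forward_orbit_def by blast
      qed
    qed
  qed
qed

text \<open>A repetition would make the orbit finite, hence closed, and a finite set is not dense in
  an interval of positive length.\<close>

lemma orbit_inj:
  assumes "0 \<le> x" "x \<le> L"
  shows "inj (\<lambda>k. (T ^^ k) x)"
proof (rule ccontr)
  let ?X = "\<lambda>k. (T ^^ k) x"
  assume "\<not> inj ?X"
  then obtain i j where ij: "i < j" "?X i = ?X j"
    unfolding inj_def by (metis linorder_neqE_nat)
  have rep: "?X (d + i) = ?X (d + j)" for d
    using ij(2) by (simp add: funpow_add)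
  have "?X k \<in> ?X ` {..<j}" for k
  proof (induction k rule: less_induct)
    case (less k)
    show ?case
    proof (cases "k < j")
      case False
      then have "?X k = ?X ((k - j) + i)" using rep[of "k - j"] by simp
      moreover have "(k - j) + i < k" using False ij(1) by simp
      ultimately show ?thesis using less by metis
    qed auto
  qed
  then have "forward_orbit T x \<subseteq> ?X ` {..<j}" by (auto simp: forward_orbit_def)
  then have fin: "finite (forward_orbit T x)" by (rule finite_subset) simp
  have "closure (forward_orbit T x) = {0..L}"
    using minimal assms unfolding minimal_on_interval_def by simp
  with fin have "finite {0..L}" by (simp add: finite_imp_closed closure_closed)
  then show False using L_pos infinite_Icc by blast
qed

text \<open>All branches of T reverse orientation, so one is given by its ends a, b and the constant
  sum c of a point and its image.\<close>

definition exchange_branch :: "real \<Rightarrow> real \<Rightarrow> real \<Rightarrow> bool" where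
  "exchange_branch a b c \<longleftrightarrow> (a, b, c) \<in> {(0, n1, n1 + n3 + n4), (n1, n1 + n2 + n3, n1 + L),
     (n1 + n2 + n3, 1 + n3, 1 + n3), (1 + n3, L, n1 + n3 + n4 + L)}"

lemma exchange_branches:
  "exchange_branch 0 n1 (n1 + n3 + n4)" "exchange_branch n1 (n1 + n2 + n3) (n1 + L)"
  "exchange_branch (n1 + n2 + n3) (1 + n3) (1 + n3)" "exchange_branch (1 + n3) L (n1 + n3 + n4 + L)"
  by (simp_all add: exchange_branch_def)

lemma exchange_branch_range:
  "exchange_branch a b c \<Longrightarrow> 0 \<le> a \<and> b \<le> L \<and> 0 \<le> c - b \<and> c - a \<le> L"
  unfolding exchange_branch_def using pos sum1 L by auto

text \<open>Images of different branches meet at most in endpoints, so an open interval inside one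
  image has its preimage in a single branch, whatever the convention at the ends.\<close>

lemma vimage_branch:
  assumes br: "exchange_branch a b c" and uv: "a \<le> u" "u < v" "v \<le> b"
  shows "T -` {c - v<..<c - u} \<inter> {0..L} = {u<..<v}"
proof -
  note l = uv L pos sum1
  consider (1) "a = 0" "b = n1" "c = n1 + n3 + n4" | (2) "a = n1" "b = n1 + n2 + n3" "c = n1 + L"
    | (3) "a = n1 + n2 + n3" "b = 1 + n3" "c = 1 + n3" | (4) "a = 1 + n3" "b = L" "c = n1 + n3 + n4 + L"
    using br unfolding exchange_branch_def by blast
  note cases = this
  have on: "T y = c - y" if y: "u < y" "y < v" for y
    using cases
  proof cases
    case 1 then show ?thesis using T1[of y] y l by linarith
  next
    case 2 then show ?thesis using T2[of y] y l by linarith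
  next
    case 3 then show ?thesis using T3[of y] y l by linarith
  next
    case 4 then show ?thesis using T4[of y] y l by linarith
  qed
  have off: "u < y \<and> y < v" if y: "0 \<le> y" "y \<le> L" "c - v < T y" "T y < c - u" for y
    using cases
  proof cases
    case 1 show ?thesis using T_cases[OF y(1,2)] by cases (use 1 y(3,4) l in linarith)+
  next
    case 2 show ?thesis using T_cases[OF y(1,2)] by cases (use 2 y(3,4) l in linarith)+
  next
    case 3 show ?thesis using T_cases[OF y(1,2)] by cases (use 3 y(3,4) l in linarith)+
  next
    case 4 show ?thesis using T_cases[OF y(1,2)] by cases (use 4 y(3,4) l in linarith)+
  qed
  have "0 \<le> a" "b \<le> L" using exchange_branch_range[OF br] by auto
  show ?thesis
  proof (intro equalityI subsetI)
    fix y assume "y \<in> T -` {c - v<..<c - u} \<inter> {0..L}"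
    then show "y \<in> {u<..<v}" using off[of y] by simp
  next
    fix y assume "y \<in> {u<..<v}"
    then show "y \<in> T -` {c - v<..<c - u} \<inter> {0..L}"
      using on[of y] \<open>0 \<le> a\<close> \<open>b \<le> L\<close> uv by simp
  qed
qed

section \<open>Invariant measures of the flipped exchange\<close>

lemma measurable_T:
  assumes "sets M = sets (restrict_space borel {0..L})"
  shows "T \<in> M \<rightarrow>\<^sub>M M"
proof -
  \<comment> \<open>T is specified on [0, L] only; \<open>G\<close> is a Borel function on the line
    that agrees with it there.\<close>
  define G where "G x = (if x < n1 then n1 + n3 + n4 - x else if x < n1 + n2 + n3 then n1 + L - x
    else if x < 1 + n3 then 1 + n3 - x else n1 + n3 + n4 + L - x)" for x
  have G: "T x = G x" if "x \<in> {0..L}" for x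
    using that T1[of x] T2[of x] T3[of x] T4[of x] by (auto simp: G_def)
  have "G \<in> borel \<rightarrow>\<^sub>M borel" unfolding G_def by measurable
  then have "G \<in> restrict_space borel {0..L} \<rightarrow>\<^sub>M borel" by (rule measurable_restrict_space1)
  then have "G \<in> restrict_space borel {0..L} \<rightarrow>\<^sub>M restrict_space borel {0..L}"
    using T_range G by (intro measurable_restrict_space2) (auto simp: space_restrict_space)
  then have "T \<in> restrict_space borel {0..L} \<rightarrow>\<^sub>M restrict_space borel {0..L}"
    using G by (subst measurable_cong[where g = G]) (auto simp: space_restrict_space)
  then show ?thesis using measurable_cong_sets[OF assms assms] by blast
qed

lemma invariant_cdf:
  assumes M: "interval_prob M L"
    and inv: "\<And>A. A \<in> sets M \<Longrightarrow> measure M (T -` A \<inter> {0..L}) = measure M A"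
    and x: "0 \<le> x" "x \<le> L"
  shows "measure M {0..x} = x / L"
proof -
  interpret interval_prob M L by fact
  define \<Phi> where "\<Phi> x = measure M {0..x}" for x
  have flip_less: "\<Phi> (c - u) - \<Phi> (c - v) = \<Phi> v - \<Phi> u"
    if br: "exchange_branch a b c" and uv: "a \<le> u" "u < v" "v \<le> b" for a b c u v
  proof -
    note r = exchange_branch_range[OF br]
    have "{c - v<..<c - u} \<in> sets M" using r uv by (intro setsI) auto
    from inv[OF this] have "measure M {c - v<..<c - u} = measure M {u<..<v}"
      unfolding vimage_branch[OF br uv] by simp
    then show ?thesis
      unfolding \<Phi>_def using r uv by (simp add: measure_interval)
  qed
  have flip: "\<Phi> (c - u) - \<Phi> (c - v) = \<Phi> v - \<Phi> u"
    if "exchange_branch a b c" "a \<le> u" "u \<le> b" "a \<le> v" "v \<le> b" for a b c u v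
    using flip_less[OF that(1), of u v] flip_less[OF that(1), of v u] that
    by (cases u v rule: linorder_cases) auto
  have add: "flip_additive \<Phi>"
    unfolding flip_additive_def
  proof (intro conjI allI impI)
    fix x y :: real assume "0 \<le> x" "x \<le> y" "y \<le> 1"
    then show "\<Phi> x \<le> \<Phi> y"
      unfolding \<Phi>_def using L_pos by (intro finite_measure_mono setsI) auto
  next
    fix i x x' y y' assume xy: "br i x x'" "br i y y'"
    note l = L pos sum1
    consider "i = 0" | "i = 1" | "i = 2" | "i = 3" using branch_less_4[OF xy(1)] by linarith
    then show "\<Phi> x' - \<Phi> y' = branch_sign i * (\<Phi> x - \<Phi> y)"
    proof cases
      case 1
      then have "x' = n1 + n3 + n4 - x" "y' = n1 + n3 + n4 - y" "0 \<le> x" "0 \<le> y" "x \<le> n1" "y \<le> n1"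
        using xy by (simp_all add: branch_def)
      with flip[OF exchange_branches(1), of x y] show ?thesis using 1 by (simp add: branch_sign_def)
    next
      case 2
      then have b: "x' = x + n3 + n4" "y' = y + n3 + n4" "n1 \<le> x" "n1 \<le> y" "x \<le> n1 + n2" "y \<le> n1 + n2"
        using xy by (simp_all add: branch_def)
      \<comment> \<open>Letter 1 is a flip in the second interval of T followed by one in the
        fourth; letter 2 passes through the second and the third.\<close>
      have "\<Phi> (n1 + L - x) - \<Phi> (n1 + L - y) = \<Phi> y - \<Phi> x"
        by (rule flip[OF exchange_branches(2)]; use b l in linarith)
      moreover have "\<Phi> (n1 + n3 + n4 + L - (n1 + L - x)) - \<Phi> (n1 + n3 + n4 + L - (n1 + L - y))
          = \<Phi> (n1 + L - y) - \<Phi> (n1 + L - x)"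
        by (rule flip[OF exchange_branches(4)]; use b l in linarith)
      moreover have "n1 + n3 + n4 + L - (n1 + L - x) = x'" "n1 + n3 + n4 + L - (n1 + L - y) = y'"
        using b by simp_all
      ultimately show ?thesis using 2 by (simp add: branch_sign_def)
    next
      case 3
      then have b: "x' = x - n1 - n2" "y' = y - n1 - n2" "n1 + n2 \<le> x" "n1 + n2 \<le> y"
          "x \<le> n1 + n2 + n3" "y \<le> n1 + n2 + n3"
        using xy by (simp_all add: branch_def)
      have "\<Phi> (n1 + L - x) - \<Phi> (n1 + L - y) = \<Phi> y - \<Phi> x"
        by (rule flip[OF exchange_branches(2)]; use b l in linarith)
      moreover have "\<Phi> (1 + n3 - (n1 + L - x)) - \<Phi> (1 + n3 - (n1 + L - y))
          = \<Phi> (n1 + L - y) - \<Phi> (n1 + L - x)"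
        by (rule flip[OF exchange_branches(3)]; use b l in linarith)
      moreover have "1 + n3 - (n1 + L - x) = x'" "1 + n3 - (n1 + L - y) = y'"
        using b L by simp_all
      ultimately show ?thesis using 3 by (simp add: branch_sign_def)
    next
      case 4
      then have b: "x' = 1 + n3 - x" "y' = 1 + n3 - y" "n1 + n2 + n3 \<le> x" "n1 + n2 + n3 \<le> y" "x \<le> 1" "y \<le> 1"
        using xy sum1 by (simp_all add: branch_def)
      have "\<Phi> (1 + n3 - x) - \<Phi> (1 + n3 - y) = \<Phi> y - \<Phi> x"
        by (rule flip[OF exchange_branches(3)]; use b l in linarith)
      then show ?thesis using 4 b by (simp add: branch_sign_def)
    qed
  qed
  have \<Phi>0: "\<Phi> 0 = 0" using no_atoms[of 0] L_pos by (simp add: \<Phi>_def)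
  have unit: "\<Phi> y = \<Phi> 1 * y" if "0 \<le> y" "y \<le> 1" for y
    using additive_linear[OF add that] \<Phi>0 by simp
  have linear: "\<Phi> y = \<Phi> 1 * y" if "0 \<le> y" "y \<le> L" for y
  proof (cases "y \<le> 1")
    case False
    \<comment> \<open>Beyond 1 linearity is pulled back through the second interval of T, whose
      right end n1 + n2 + n3 corresponds to 1.\<close>
    define u where "u = n1 + L - y"
    have u: "n1 \<le> u" "u \<le> n1 + n2 + n3" using that False L by (auto simp: u_def)
    have "\<Phi> (n1 + L - u) - \<Phi> (n1 + L - (n1 + n2 + n3)) = \<Phi> (n1 + n2 + n3) - \<Phi> u"
      by (rule flip[OF exchange_branches(2)]; use u pos in linarith)
    moreover have "n1 + L - u = y" "n1 + L - (n1 + n2 + n3) = 1" using L by (simp_all add: u_def)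
    ultimately have "\<Phi> y - \<Phi> 1 = \<Phi> (n1 + n2 + n3) - \<Phi> u" by (simp only:)
    moreover have "\<Phi> (n1 + n2 + n3) = \<Phi> 1 * (n1 + n2 + n3)" "\<Phi> u = \<Phi> 1 * u"
      by (rule unit; use u pos sum1 in linarith)+
    ultimately have "\<Phi> y = \<Phi> 1 * (1 + (n1 + n2 + n3) - u)"
      by (simp only: right_diff_distrib distrib_left)
    also have "1 + (n1 + n2 + n3) - u = y" using L by (simp add: u_def)
    finally show ?thesis .
  qed (rule unit[OF that(1)])
  have "\<Phi> L = 1" using prob_space space_M by (simp add: \<Phi>_def)
  with linear[of L] L_pos have "\<Phi> 1 = 1 / L" by (simp add: field_simps)
  with linear[OF x] show ?thesis by (simp add: \<Phi>_def)
qed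

text \<open>A point lies in the preimage of its image, so by invariance masses do not decrease along
  an orbit. An atom would give infinitely many distinct points of mass at least a.\<close>

lemma invariant_no_atoms:
  assumes "prob_space M" and sets: "sets M = sets (restrict_space borel {0..L})"
    and inv: "\<And>A. A \<in> sets M \<Longrightarrow> measure M (T -` A \<inter> {0..L}) = measure M A"
    and x: "0 \<le> x" "x \<le> L"
  shows "measure M {x} = 0"
proof (rule ccontr)
  interpret prob_space M by fact
  let ?X = "\<lambda>k. (T ^^ k) x"
  have setsI: "A \<in> sets M" if "A \<in> sets borel" "A \<subseteq> {0..L}" for A
    using that unfolding sets by (auto simp: sets_restrict_space)
  define a where "a = measure M {x}"
  assume "measure M {x} \<noteq> 0"
  then have "a > 0" by (simp add: a_def zero_less_measure_iff)
  have single: "{?X k} \<in> sets M" for k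
    using orbit_range[OF x, of k] by (intro setsI) auto
  have atom: "a \<le> measure M {?X k}" for k
  proof (induction k)
    case (Suc k)
    have T: "T \<in> M \<rightarrow>\<^sub>M M" using measurable_T[OF sets] .
    have "space M = {0..L}" using sets_eq_imp_space_eq[OF sets] by (simp add: space_restrict_space)
    with measurable_sets[OF T single[of "Suc k"]]
    have "T -` {?X (Suc k)} \<inter> {0..L} \<in> sets M" by simp
    then have "measure M {?X k} \<le> measure M (T -` {?X (Suc k)} \<inter> {0..L})"
      using orbit_range[OF x, of k] by (intro finite_measure_mono) auto
    then show ?case using Suc inv[OF single[of "Suc k"]] by simp
  qed (simp add: a_def)
  obtain N where N: "1 < real N * a" using \<open>a > 0\<close> reals_Archimedean3 by blast
  have "real N * a \<le> (\<Sum>k<N. measure M {?X k})"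
    using sum_bounded_below[of "{..<N}" a "\<lambda>k. measure M {?X k}"] atom by simp
  also have "\<dots> = measure M (\<Union>k<N. {?X k})"
    using single orbit_inj[OF x]
    by (intro finite_measure_finite_Union[symmetric]) (auto simp: disjoint_family_on_def inj_def)
  also have "\<dots> \<le> 1" by simp
  finally show False using N by simp
qed

lemma interval_prob_normalized_lebesgue: "interval_prob (normalized_lebesgue L) L"
proof -
  interpret prob_space "normalized_lebesgue L"
    by (rule prob_space_normalized_lebesgue) (rule L_pos)
  show ?thesis
  proof
    show "sets (normalized_lebesgue L) = sets (restrict_space borel {0..L})"
      by (rule sets_normalized_lebesgue)
    show "measure (normalized_lebesgue L) {x} = 0" if "0 \<le> x" "x \<le> L" for x
      using that L_pos by (simp add: measure_def emeasure_normalized_lebesgue)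
  qed
qed

text \<open>Unique ergodicity includes the invariance of Lebesgue measure. Each point has at most
  four preimages, so the image measure has no atoms and its cdf can be computed branch by
  branch.\<close>

lemma distr_normalized_lebesgue:
  "distr (normalized_lebesgue L) (normalized_lebesgue L) T = normalized_lebesgue L"
proof -
  interpret N: interval_prob "normalized_lebesgue L" L by (rule interval_prob_normalized_lebesgue)
  let ?N = "normalized_lebesgue L"
  have T: "T \<in> ?N \<rightarrow>\<^sub>M ?N" by (rule measurable_T[OF sets_normalized_lebesgue])
  define D where "D = distr ?N ?N T"
  have prob: "prob_space D" unfolding D_def by (rule N.prob_space_distr[OF T])
  have sets: "sets D = sets (restrict_space borel {0..L})"
    unfolding D_def by (simp add: sets_normalized_lebesgue)
  have D: "measure D A = measure ?N (T -` A \<inter> {0..L})" if "A \<in> sets borel" "A \<subseteq> {0..L}" for A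
    unfolding D_def using that T N.setsI by (simp add: measure_distr N.space_M)
  have "interval_prob D L"
  proof (intro interval_prob.intro interval_prob_axioms.intro prob sets)
    fix x assume x: "0 \<le> x" "x \<le> L"
    have sub: "T -` {x} \<inter> {0..L} \<subseteq> {n1 + n3 + n4 - x, n1 + L - x, 1 + n3 - x, n1 + n3 + n4 + L - x} \<inter> {0..L}"
      (is "?A \<subseteq> ?B")
    proof
      fix y assume "y \<in> T -` {x} \<inter> {0..L}"
      then show "y \<in> ?B" by (auto elim: T_cases[of y])
    qed
    have "measure ?N ?B = 0"
    proof -
      have "?B \<in> sets borel" by simp
      moreover have "emeasure lborel ?B = 0" by (intro emeasure_lborel_countable) simp
      ultimately show ?thesis using L_pos by (simp add: measure_def emeasure_normalized_lebesgue)
    qed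
    moreover have "measure ?N ?A \<le> measure ?N ?B"
      using sub by (intro N.finite_measure_mono N.setsI) auto
    ultimately show "measure D {x} = 0"
      using D[of "{x}"] x measure_nonneg[of ?N ?A] by simp
  qed
  then interpret D: interval_prob D L .
  define f where "f x = measure D {0..x}" for x
  have inc: "f (c - u) - f (c - b) = (b - u) / L" if br: "exchange_branch a b c" and u: "a \<le> u" "u \<le> b" for a b c u
  proof (cases "u = b")
    case False
    then have "u < b" using u by simp
    note r = exchange_branch_range[OF br]
    have "measure D {c - b<..<c - u} = measure ?N {u<..<b}"
      using r u by (subst D) (auto simp: vimage_branch[OF br u(1) \<open>u < b\<close>])
    also have "\<dots> = (b - u) / L"
      using r u L_pos by (simp add: N.measure_interval measure_normalized_lebesgue diff_divide_distrib)
    finally show ?thesis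
      unfolding f_def using r u by (simp add: D.measure_interval)
  qed simp
  have f0: "f 0 = 0" using D.no_atoms[of 0] L_pos by (simp add: f_def)
  have step: "f x = x / L"
    if "exchange_branch a b c" "d = c - b" "d \<le> x" "x \<le> c - a" "f d = d / L" for a b c d x
    using inc[OF that(1), of "c - x"] that by (simp add: diff_divide_distrib add_divide_distrib)
  note l = L pos sum1
  \<comment> \<open>From left to right the images are those of the third, first, fourth and second
    interval of T; the value at the end of one image starts the next.\<close>
  have 1: "f x = x / L" if "0 \<le> x" "x \<le> n3 + n4" for x
    by (rule step[OF exchange_branches(3), of 0]) (use that f0 l in auto)
  have 2: "f x = x / L" if "n3 + n4 \<le> x" "x \<le> n1 + n3 + n4" for x
    by (rule step[OF exchange_branches(1) _ that(1)], simp, use that in simp, rule 1; use l in linarith)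
  have 3: "f x = x / L" if "n1 + n3 + n4 \<le> x" "x \<le> 1" for x
    by (rule step[OF exchange_branches(4) _ that(1)], simp, use that l in linarith, rule 2; use l in linarith)
  have 4: "f x = x / L" if "1 \<le> x" "x \<le> L" for x
    by (rule step[OF exchange_branches(2) _ that(1)], use l in linarith, use that in linarith,
        rule 3; use l in linarith)
  have "f x = x / L" if "0 \<le> x" "x \<le> L" for x
    using that 1[of x] 2[of x] 3[of x] 4[of x] by linarith
  then show ?thesis
    using prob N.prob_space_axioms sets sets_normalized_lebesgue L_pos
    by (intro interval_prob_eqI[of _ _ L]) (auto simp: D_def[symmetric] f_def measure_normalized_lebesgue)
qed

theorem uniquely_ergodic: "uniquely_ergodic_on_interval L T"
  unfolding uniquely_ergodic_on_interval_def
proof (intro allI iffI)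
  fix M assume "invariant_borel_prob L T M"
  then have sets: "sets M = sets (restrict_space borel {0..L})" and one: "emeasure M (space M) = 1"
    and T: "T \<in> M \<rightarrow>\<^sub>M M" and distr: "distr M M T = M"
    unfolding invariant_borel_prob_def by auto
  have space: "space M = {0..L}"
    using sets_eq_imp_space_eq[OF sets] by (simp add: space_restrict_space)
  have prob: "prob_space M" using one by (rule prob_spaceI)
  have inv: "measure M (T -` A \<inter> {0..L}) = measure M A" if "A \<in> sets M" for A
    using measure_distr[OF T that] unfolding distr space by simp
  have "interval_prob M L"
    using prob sets invariant_no_atoms[OF prob sets inv]
    by (intro interval_prob.intro interval_prob_axioms.intro) auto
  from invariant_cdf[OF this inv] show "M = normalized_lebesgue L"
    using prob prob_space_normalized_lebesgue sets sets_normalized_lebesgue L_pos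
    by (intro interval_prob_eqI[of _ _ L]) (auto simp: measure_normalized_lebesgue)
next
  fix M assume "M = normalized_lebesgue L"
  moreover have "invariant_borel_prob L T (normalized_lebesgue L)"
    unfolding invariant_borel_prob_def
    using sets_normalized_lebesgue prob_space.emeasure_space_1[OF prob_space_normalized_lebesgue]
      measurable_T distr_normalized_lebesgue L_pos by auto
  ultimately show "invariant_borel_prob L T M" by simp
qed

end

section \<open>From the matrices P and Q to the exchange in the lengths n\<close>

theorem theorem2p1:
  fixes \<eta> :: real and \<nu> l :: "real Matrix.vec"
  assumes "perron_frobenius_eigenvalue P_mat \<eta>"
    and "eigenvector P_mat \<nu> \<eta>"
    and "positive_probability_vec 4 \<nu>"
    and "l = Q_mat *\<^sub>v \<nu>"
  shows "minimal_on_interval (total_length l) (flip_map l) \<and>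
         uniquely_ergodic_on_interval (total_length l) (flip_map l)"
proof -
  have \<nu>: "\<nu> \<in> carrier_vec 4" and pos: "\<And>i. i < 4 \<Longrightarrow> 0 < \<nu> $ i" and sum: "(\<Sum>i<4. \<nu> $ i) = 1"
    using assms(3) unfolding positive_probability_vec_def by auto
  have mult: "(mat_of_rows_list 4 A *\<^sub>v \<nu>) $ i = (\<Sum>j<4. A ! i ! j * \<nu> $ j)"
    if "i < length A" for A i
    using that \<nu> by (simp add: mat_of_rows_list_def scalar_prod_def lessThan_atLeast0)
  have "P_mat *\<^sub>v \<nu> = \<eta> \<cdot>\<^sub>v \<nu>"
    using assms(2) by (simp add: eigenvector_def)
  then have eig: "(P_mat *\<^sub>v \<nu>) $ i = \<eta> * \<nu> $ i" if "i < 4" for i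
    using \<nu> that by simp
  have P: "perron_direction \<eta> (\<nu> $ 0) (\<nu> $ 1) (\<nu> $ 2) (\<nu> $ 3)"
    using pos[of 0] pos[of 1] pos[of 2] pos[of 3] sum eig[of 0] eig[of 1] eig[of 2] eig[of 3]
    unfolding P_mat_def by unfold_locales (simp_all add: mult sum_less_4)
  \<comment> \<open>The rows of Q: the second interval collects the two middle letters, the third
    contains the last letter and continues beyond 1, and the fourth lies entirely beyond 1.\<close>
  have l: "l $ 0 = \<nu> $ 0" "l $ 1 = \<nu> $ 1 + \<nu> $ 2" "l $ 2 = \<nu> $ 2 + \<nu> $ 3" "l $ 3 = \<nu> $ 1"
    unfolding assms(4) Q_mat_def by (simp_all add: mult sum_less_4)
  interpret flipped_exchange \<eta> "\<nu> $ 0" "\<nu> $ 1" "\<nu> $ 2" "\<nu> $ 3" "total_length l" "flip_map l"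
  proof (intro flipped_exchange.intro flipped_exchange_axioms.intro P)
    have sum': "\<nu> $ 0 + \<nu> $ 1 + \<nu> $ 2 + \<nu> $ 3 = 1"
      using sum by (simp add: sum_less_4)
    have p: "0 < \<nu> $ 0" "0 < \<nu> $ 1" "0 < \<nu> $ 2" "0 < \<nu> $ 3"
      using pos by simp_all
    note d = flip_map_def interval1_def interval2_def interval3_def interval4_def atLeastLessThan_iff
      atLeastAtMost_iff l
    show L: "total_length l = 1 + \<nu> $ 1 + \<nu> $ 2"
      unfolding total_length_def l using sum' by simp
    show "flip_map l x = \<nu> $ 0 + \<nu> $ 2 + \<nu> $ 3 - x" if "0 \<le> x" "x < \<nu> $ 0" for x
      unfolding d using that by simp
    show "flip_map l x = \<nu> $ 0 + total_length l - x" if "\<nu> $ 0 \<le> x" "x < \<nu> $ 0 + \<nu> $ 1 + \<nu> $ 2" for x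
      unfolding d using that by simp
    show "flip_map l x = 1 + \<nu> $ 2 - x" if "\<nu> $ 0 + \<nu> $ 1 + \<nu> $ 2 \<le> x" "x < 1 + \<nu> $ 2" for x
      unfolding d using that p sum' by simp
    show "flip_map l x = \<nu> $ 0 + \<nu> $ 2 + \<nu> $ 3 + total_length l - x" if "1 + \<nu> $ 2 \<le> x" "x \<le> total_length l" for x
      unfolding d using that p sum' by simp
  qed
  show ?thesis using minimal uniquely_ergodic by blast
qed

end
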